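(* Consider smooth, rapidly decaying axisymmetric solutions of the three-dimensional incompressible Navier--Stokes equations with viscosity $\nu>0$, and set $b=(u^r,u^z)$, $F=u^\theta/r$, $\Gamma=ru^\theta$, $G=\omega^\theta/r$, $U=u^r/r$, $W=\Gamma_z/r$. Among power weights $d\mu_\alpha=r^\alpha\,dr\,dz$ with $\alpha>1$, the exponent $\alpha=3$ is the unique value for which the following three properties hold simultaneously: (i) the $F$-equation is conservative with respect to $\mu_\alpha$: $F_t+\operatorname{div}_{\mu_\alpha}(bF)=\nu\Delta_5F$ (for all such solutions); (ii) $\Delta_5$ is formally self-adjoint in $L^2(d\mu_\alpha)$; (iii) the $G$-source pairing has no radial weight: $\int G\,\partial_z(F^2)\,d\mu_\alpha=2\int\Gamma WG\,dr\,dz$ (for all such solutions). Moreover, among the powers $3\le\alpha<5$, $\alpha=3$ uniquely minimizes the ratio $$\frac{(\alpha-1)/2}{(5-\alpha)/(\alpha-1)}=\frac{(\alpha-1)^2}{2(5-\alpha)}$$ of the $G$-compression coefficient to the sharp radial gap, equivalently maximizes the absorbable form-bound constant $\frac{2\nu(5-\alpha)}{(\alpha-1)^2}$. Likewise, for every $p>1$, over the range $3\le\alpha<2p+1$, $\alpha=3$ minimizes the ratio $$\frac{(2p+1-\alpha)/p}{c_{\alpha,p}}=\frac{p(\alpha-1)}4,\qquad c_{\alpha,p}=\frac{4(2p+1-\alpha)}{p^2(\alpha-1)},$$ and maximizes the form-bound threshold $\frac{4\nu}{p(\alpha-1)}$.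
   Context: Cylindrical coordinates $(r,\theta,z)$; $u=u^re_r+u^\theta e_\theta+u^ze_z$ with components depending on $(r,z,t)$; $\omega^\theta=\partial_zu^r-\partial_ru^z$. Integrals are over $(r,z)\in(0,\infty)\times\mathbb R$. ``Smooth rapidly decaying'' means that $u$ is smooth as a Cartesian vector field, including across the axis, and that $u$ and its derivatives decay faster than any power of $|x|$, locally uniformly in $t$. Incompressibility: $\partial_ru^r+\frac{u^r}r+\partial_zu^z=0$. Define $\Delta_5=\partial_{rr}+\frac3r\partial_r+\partial_{zz}$ and, for a meridional field $v=(v^r,v^z)$, $\operatorname{div}_{\mu_\alpha}v=r^{-\alpha}[\partial_r(r^\alpha v^r)+\partial_z(r^\alpha v^z)]$. The functions $F,G$ satisfy $$F_t+u^rF_r+u^zF_z=\nu\Delta_5F-2UF,\qquad G_t+u^rG_r+u^zG_z=\nu\Delta_5G+\partial_z(F^2).$$ Formal self-adjointness of $\Delta_5$ in $L^2(d\mu_\alpha)$ means $\int(\Delta_5\varphi)\psi\,d\mu_\alpha=\int\varphi\,\Delta_5\psi\,d\mu_\alpha$ for all $\varphi,\psi\in C_c^\infty((0,\infty)\times\mathbb R)$. Origin of the ratios. In the energy identity for $\int G^2r^\alpha\,dr\,dz$ the strain term is $\frac{\alpha-1}{2}\int UG^2r^\alpha\,dr\,dz$, and for $3\le\alpha<5$ the diffusion form $\int|\nabla G|^2r^\alpha+\frac{(3-\alpha)(\alpha-1)}{2}\int G^2r^{\alpha-2}$ is bounded below with sharp constant $\frac{5-\alpha}{\alpha-1}$ times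 the weighted gradient energy. In the energy identity for $\int|F|^pr^\alpha\,dr\,dz$ the strain coefficient has magnitude $\frac{2p+1-\alpha}{p}$, and the diffusion form has sharp lower bound $c_{\alpha,p}$ times the weighted gradient energy of $|F|^{p/2}$. The form-bound constants are the thresholds for $\Lambda$ obtained by requiring (strain coefficient)$\cdot\Lambda<\nu\cdot$(sharp gap). *)

theory Defs
  imports "HOL-Analysis.Analysis"
begin

section \<open>Smooth functions\<close>

definition ddir :: "'a::real_normed_vector \<Rightarrow> ('a \<Rightarrow> 'b::real_normed_vector) \<Rightarrow> 'a \<Rightarrow> 'b" where
  "ddir v f x = frechet_derivative f (at x) v"

text \<open>The following two definitions are meant for open sets in Euclidean spaces only.\<close>

primrec C_k_on :: "nat \<Rightarrow> 'a::euclidean_space set \<Rightarrow> ('a \<Rightarrow> 'b::real_normed_vector) \<Rightarrow> bool" where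
  "C_k_on 0 S f \<longleftrightarrow> continuous_on S f"
| "C_k_on (Suc k) S f \<longleftrightarrow> (\<forall>x\<in>S. f differentiable (at x)) \<and> (\<forall>v. C_k_on k S (ddir v f))"

definition smooth_on :: "'a::euclidean_space set \<Rightarrow> ('a \<Rightarrow> 'b::real_normed_vector) \<Rightarrow> bool" where
  "smooth_on S f \<longleftrightarrow> (\<forall>k. C_k_on k S f)"


section \<open>Axisymmetric Navier--Stokes solutions in Cartesian coordinates\<close>

type_synonym velocity = "real \<Rightarrow> real^3 \<Rightarrow> real^3"
type_synonym pressure = "real \<Rightarrow> real^3 \<Rightarrow> real"

definition partial :: "3 \<Rightarrow> (real^3 \<Rightarrow> 'b::real_normed_vector) \<Rightarrow> real^3 \<Rightarrow> 'b" where
  "partial i f = ddir (axis i 1) f"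

primrec partials :: "3 list \<Rightarrow> (real^3 \<Rightarrow> 'b::real_normed_vector) \<Rightarrow> real^3 \<Rightarrow> 'b" where
  "partials [] f = f"
| "partials (i # is) f = partial i (partials is f)"

definition navier_stokes :: "real \<Rightarrow> real set \<Rightarrow> velocity \<Rightarrow> pressure \<Rightarrow> bool" where
  "navier_stokes \<nu> T u p \<longleftrightarrow> (\<forall>t\<in>T. \<forall>x.
      vector_derivative (\<lambda>s. u s x) (at t) + ddir (u t x) (u t) x
        = - (\<chi> i. partial i (p t) x) + \<nu> *\<^sub>R (\<Sum>i\<in>UNIV. partial i (partial i (u t)) x)
      \<and> (\<Sum>i\<in>UNIV. partial i (u t) x $ i) = 0)"

text \<open>Decay of all spatial derivatives, locally uniformly in time. That
  \<open>norm x ^ k\<close> times a derivative is bounded for every \<open>k\<close> is the same as its tending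
  to zero at infinity for every \<open>k\<close>, as \<open>u\<close> is smooth.\<close>

definition rapidly_decaying :: "real set \<Rightarrow> velocity \<Rightarrow> bool" where
  "rapidly_decaying T u \<longleftrightarrow> (\<forall>is k K. compact K \<and> K \<subseteq> T \<longrightarrow>
      (\<exists>C. \<forall>t\<in>K. \<forall>x. norm x ^ k * norm (partials is (u t) x) \<le> C))"

definition cyl :: "real \<Rightarrow> real \<Rightarrow> real \<Rightarrow> real^3" where
  "cyl r \<theta> z = vector [r * cos \<theta>, r * sin \<theta>, z]"

definition e_r :: "real \<Rightarrow> real^3" where
  "e_r \<theta> = vector [cos \<theta>, sin \<theta>, 0]"

definition e_theta :: "real \<Rightarrow> real^3" where
  "e_theta \<theta> = vector [- sin \<theta>, cos \<theta>, 0]"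

definition e_z :: "real^3" where
  "e_z = vector [0, 0, 1]"

text \<open>The cylindrical components as functions of \<open>t\<close> and of \<open>q = (r, z)\<close>, read off in the
  half-plane \<open>\<theta> = 0\<close>. For an axisymmetric field the choice of \<open>\<theta>\<close> is immaterial.\<close>

definition u_r :: "velocity \<Rightarrow> real \<Rightarrow> real \<times> real \<Rightarrow> real" where
  "u_r u t q = u t (cyl (fst q) 0 (snd q)) \<bullet> e_r 0"

definition u_theta :: "velocity \<Rightarrow> real \<Rightarrow> real \<times> real \<Rightarrow> real" where
  "u_theta u t q = u t (cyl (fst q) 0 (snd q)) \<bullet> e_theta 0"

definition u_z :: "velocity \<Rightarrow> real \<Rightarrow> real \<times> real \<Rightarrow> real" where
  "u_z u t q = u t (cyl (fst q) 0 (snd q)) \<bullet> e_z"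

definition axisymmetric :: "real set \<Rightarrow> velocity \<Rightarrow> bool" where
  "axisymmetric T u \<longleftrightarrow> (\<forall>t\<in>T. \<forall>r>0. \<forall>\<theta> z.
      u t (cyl r \<theta> z) =
        u_r u t (r, z) *\<^sub>R e_r \<theta> + u_theta u t (r, z) *\<^sub>R e_theta \<theta> + u_z u t (r, z) *\<^sub>R e_z)"

definition ns_solution :: "real \<Rightarrow> real set \<Rightarrow> velocity \<Rightarrow> bool" where
  "ns_solution \<nu> T u \<longleftrightarrow>
      open T \<and> is_interval T \<and>
      smooth_on (T \<times> UNIV) (\<lambda>(t, x). u t x) \<and> rapidly_decaying T u \<and> axisymmetric T u \<and>
      (\<exists>p. smooth_on (T \<times> UNIV) (\<lambda>(t, x). p t x) \<and> navier_stokes \<nu> T u p)"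


section \<open>The meridional half-plane\<close>

definition half_plane :: "(real \<times> real) set" where
  "half_plane = {0<..} \<times> UNIV"

abbreviation D_r :: "(real \<times> real \<Rightarrow> real) \<Rightarrow> real \<times> real \<Rightarrow> real" where
  "D_r \<equiv> ddir (1, 0)"

abbreviation D_z :: "(real \<times> real \<Rightarrow> real) \<Rightarrow> real \<times> real \<Rightarrow> real" where
  "D_z \<equiv> ddir (0, 1)"

definition omega_theta :: "velocity \<Rightarrow> real \<Rightarrow> real \<times> real \<Rightarrow> real" where
  "omega_theta u t q = D_z (u_r u t) q - D_r (u_z u t) q"

definition F_of :: "velocity \<Rightarrow> real \<Rightarrow> real \<times> real \<Rightarrow> real" where
  "F_of u t q = u_theta u t q / fst q"

definition Gamma_of :: "velocity \<Rightarrow> real \<Rightarrow> real \<times> real \<Rightarrow> real" where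
  "Gamma_of u t q = fst q * u_theta u t q"

definition G_of :: "velocity \<Rightarrow> real \<Rightarrow> real \<times> real \<Rightarrow> real" where
  "G_of u t q = omega_theta u t q / fst q"

definition W_of :: "velocity \<Rightarrow> real \<Rightarrow> real \<times> real \<Rightarrow> real" where
  "W_of u t q = D_z (Gamma_of u t) q / fst q"

definition Delta5 :: "(real \<times> real \<Rightarrow> real) \<Rightarrow> real \<times> real \<Rightarrow> real" where
  "Delta5 f q = D_r (D_r f) q + 3 / fst q * D_r f q + D_z (D_z f) q"

definition div_mu ::
  "real \<Rightarrow> (real \<times> real \<Rightarrow> real) \<Rightarrow> (real \<times> real \<Rightarrow> real) \<Rightarrow> real \<times> real \<Rightarrow> real" where
  "div_mu \<alpha> vr vz q = fst q powr (- \<alpha>) *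
      (D_r (\<lambda>q. fst q powr \<alpha> * vr q) q + D_z (\<lambda>q. fst q powr \<alpha> * vz q) q)"

definition integral_mu :: "real \<Rightarrow> (real \<times> real \<Rightarrow> real) \<Rightarrow> real" where
  "integral_mu \<alpha> f = (LINT q:half_plane|lborel. f q * fst q powr \<alpha>)"

definition test_function :: "(real \<times> real \<Rightarrow> real) \<Rightarrow> bool" where
  "test_function \<phi> \<longleftrightarrow> smooth_on UNIV \<phi> \<and>
      compact (closure {q. \<phi> q \<noteq> 0}) \<and> closure {q. \<phi> q \<noteq> 0} \<subseteq> half_plane"


section \<open>The three properties of the weight\<close>

definition conservative_F :: "real \<Rightarrow> real \<Rightarrow> bool" where
  "conservative_F \<nu> \<alpha> \<longleftrightarrow> (\<forall>T u. ns_solution \<nu> T u \<longrightarrow> (\<forall>t\<in>T. \<forall>q\<in>half_plane.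
      deriv (\<lambda>s. F_of u s q) t
        + div_mu \<alpha> (\<lambda>q. u_r u t q * F_of u t q) (\<lambda>q. u_z u t q * F_of u t q) q
      = \<nu> * Delta5 (F_of u t) q))"

definition Delta5_self_adjoint :: "real \<Rightarrow> bool" where
  "Delta5_self_adjoint \<alpha> \<longleftrightarrow> (\<forall>\<phi> \<psi>. test_function \<phi> \<and> test_function \<psi> \<longrightarrow>
      integral_mu \<alpha> (\<lambda>q. Delta5 \<phi> q * \<psi> q) = integral_mu \<alpha> (\<lambda>q. \<phi> q * Delta5 \<psi> q))"

definition unweighted_G_source :: "real \<Rightarrow> real \<Rightarrow> bool" where
  "unweighted_G_source \<nu> \<alpha> \<longleftrightarrow> (\<forall>T u. ns_solution \<nu> T u \<longrightarrow> (\<forall>t\<in>T.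
      integral_mu \<alpha> (\<lambda>q. G_of u t q * D_z (\<lambda>q. (F_of u t q)\<^sup>2) q)
      = 2 * (LINT q:half_plane|lborel. Gamma_of u t q * W_of u t q * G_of u t q)))"


section \<open>Strain coefficients, sharp gaps and form-bound thresholds\<close>

definition gradient_energy :: "real \<Rightarrow> (real \<times> real \<Rightarrow> real) \<Rightarrow> real" where
  "gradient_energy \<alpha> h = integral_mu \<alpha> (\<lambda>q. (D_r h q)\<^sup>2 + (D_z h q)\<^sup>2)"

text \<open>The largest constant \<open>c\<close> such that the quadratic form \<open>Q\<close> is bounded below by \<open>c\<close>
  times the weighted gradient energy.\<close>

definition sharp_gap :: "real \<Rightarrow> ((real \<times> real \<Rightarrow> real) \<Rightarrow> real) \<Rightarrow> real" where
  "sharp_gap \<alpha> Q = Sup {c. \<forall>h. test_function h \<longrightarrow> c * gradient_energy \<alpha> h \<le> Q h}"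

text \<open>Energy identity for \<open>G\<close>: multiply the equation by \<open>G\<close> and integrate. Since the divergence
  of \<open>b\<close> with respect to \<open>\<mu>\<^sub>\<alpha>\<close> is \<open>(\<alpha> - 1) U\<close>, the transport term becomes
  \<open>(\<alpha> - 1) / 2\<close> times the integral of \<open>U G\<^sup>2\<close>, and integration by parts in the
  viscous term gives the form below.\<close>

definition G_strain :: "real \<Rightarrow> real" where
  "G_strain \<alpha> = (\<alpha> - 1) / 2"

definition G_diffusion_form :: "real \<Rightarrow> (real \<times> real \<Rightarrow> real) \<Rightarrow> real" where
  "G_diffusion_form \<alpha> g =
      gradient_energy \<alpha> g + (3 - \<alpha>) * (\<alpha> - 1) / 2 * integral_mu (\<alpha> - 2) (\<lambda>q. (g q)\<^sup>2)"

definition G_gap :: "real \<Rightarrow> real" where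
  "G_gap \<alpha> = sharp_gap \<alpha> (G_diffusion_form \<alpha>)"

text \<open>Energy identity for \<open>F\<close>: multiply the equation by \<open>|F| powr (p - 2) * F\<close> and integrate. The
  strain coefficient is \<open>(\<alpha> - 1) / p - 2\<close>, of which \<open>F_strain\<close> is the magnitude for
  \<open>\<alpha> < 2 p + 1\<close>. The diffusion term, minus the integral of
  \<open>\<Delta>\<^sub>5 F * |F| powr (p - 2) * F\<close>, is after integration by parts the form below in
  \<open>h = |F| powr (p / 2)\<close>; for \<open>p = 2\<close> it is the form for \<open>G\<close>.\<close>

definition F_strain :: "real \<Rightarrow> real \<Rightarrow> real" where
  "F_strain \<alpha> p = (2 * p + 1 - \<alpha>) / p"

definition F_diffusion_form :: "real \<Rightarrow> real \<Rightarrow> (real \<times> real \<Rightarrow> real) \<Rightarrow> real" where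
  "F_diffusion_form \<alpha> p h =
      4 * (p - 1) / p\<^sup>2 * gradient_energy \<alpha> h
      + (3 - \<alpha>) * (\<alpha> - 1) / p * integral_mu (\<alpha> - 2) (\<lambda>q. (h q)\<^sup>2)"

definition F_gap :: "real \<Rightarrow> real \<Rightarrow> real" where
  "F_gap \<alpha> p = sharp_gap \<alpha> (F_diffusion_form \<alpha> p)"

definition form_bound_threshold :: "real \<Rightarrow> real \<Rightarrow> real \<Rightarrow> real" where
  "form_bound_threshold \<nu> strain gap = Sup {\<Lambda>. strain * \<Lambda> < \<nu> * gap}"

end

theory Submission
  imports Defs
begin

text \<open>
  \<^bold>\<open>The three properties.\<close> For test functions, Green's formula in \<open>L\<^sup>2(\<mu>\<^sub>\<alpha>)\<close> reads
  \<open>\<integral>(\<Delta>\<^sub>5 \<phi>) \<psi> d\<mu>\<^sub>\<alpha> - \<integral>\<phi> \<Delta>\<^sub>5 \<psi> d\<mu>\<^sub>\<alpha> = (3 - \<alpha>) \<integral>(\<phi>\<^sub>r \<psi> - \<phi> \<psi>\<^sub>r) d\<mu>\<^sub>\<alpha>\<^sub>-\<^sub>1\<close>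
  (\<open>Delta5_Green\<close>): the first-order coefficient \<open>3 / r\<close> of \<open>\<Delta>\<^sub>5\<close> is matched by the weight exactly when
  \<open>\<alpha> = 3\<close>. The choice \<open>\<phi> = r \<psi>\<close> turns the last integrand into \<open>\<psi>\<^sup>2\<close>, so property (ii) pins the
  exponent to \<open>3\<close> (\<open>Delta5_self_adjoint_iff\<close>). Conversely, let \<open>\<alpha> = 3\<close>. Property (i) is the equation for
  \<open>F = u\<^sup>\<theta> / r\<close>, in which \<open>2 U F\<close> and the transport term combine to a divergence. It comes from the
  azimuthal component of the momentum equation, and there the only point beyond the chain rule is that the
  pressure has no azimuthal force (\<open>NS_residual_azimuthal\<close>). Property (iii) is a pointwise identity
  between the integrands, since \<open>F\<^sup>2 r\<^sup>3 = \<Gamma>\<^sup>2 / r\<close> and therefore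
  \<open>\<partial>\<^sub>z(F\<^sup>2) r\<^sup>3 = 2 \<Gamma> W\<close> (\<open>G_source\<close>).

  \<^bold>\<open>The gaps.\<close> Writing \<open>h = r powr (- \<kappa> / 2) * w\<close> with \<open>\<kappa> = \<alpha> - 1\<close> (the virtual ground state of Hardy's
  inequality) gives the identity
  \<open>\<integral>|\<nabla>h|\<^sup>2 d\<mu>\<^sub>\<alpha> = \<kappa>\<^sup>2 / 4 \<integral>h\<^sup>2 d\<mu>\<^sub>\<alpha>\<^sub>-\<^sub>2 + \<integral>|\<nabla>w|\<^sup>2 r dr dz\<close> (\<open>Hardy_identity\<close>,
  where \<open>r powr (- \<kappa> / 2) * w\<^sub>r\<close> appears as \<open>h\<^sub>r + \<kappa> h / (2 r)\<close>). It yields Hardy's inequality with constant \<open>4 / \<kappa>\<^sup>2\<close>, and the constant is sharp because \<open>w = \<chi>(\<epsilon> ln r) \<chi>(\<delta> z)\<close> makes the last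
  integral negligible against \<open>\<integral>w\<^sup>2 r\<^sup>-\<^sup>1 dr dz\<close> when first \<open>\<delta>\<close> and then \<open>\<epsilon>\<close> tends to \<open>0\<close>. Hence a form
  \<open>a \<integral>|\<nabla>h|\<^sup>2 d\<mu>\<^sub>\<alpha> + b \<integral>h\<^sup>2 d\<mu>\<^sub>\<alpha>\<^sub>-\<^sub>2\<close> with \<open>b \<le> 0\<close> has sharp gap \<open>a + 4 b / \<kappa>\<^sup>2\<close> (\<open>sharp_gap_eq\<close>). Both
  diffusion forms are of this kind, and the ratios and thresholds are then explicit functions that are
  strictly monotone in \<open>\<alpha>\<close>.
\<close>


section \<open>Directional derivatives and smoothness\<close>

lemma ddir_eqI: "(f has_derivative f') (at x) \<Longrightarrow> ddir v f x = f' v"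
  using frechet_derivative_at[of f f' x] by (simp add: ddir_def)

lemma has_derivative_ddir: "f differentiable (at x) \<Longrightarrow> (f has_derivative (\<lambda>v. ddir v f x)) (at x)"
  unfolding ddir_def by (simp add: frechet_derivative_works[symmetric])

lemma linear_ddir: "f differentiable (at x) \<Longrightarrow> linear (\<lambda>v. ddir v f x)"
  by (rule has_derivative_linear[OF has_derivative_ddir])

text \<open>Differentiating is local, so formulas that hold on an open set may be differentiated there. This is what
allows all computations below to ignore the values on and beyond the axis \<open>r = 0\<close>.\<close>

lemma ddir_cong_open:
  assumes "open S" "x \<in> S" "\<And>y. y \<in> S \<Longrightarrow> f y = g y"
  shows "ddir v f x = ddir v g x"
proof -
  have "(f has_derivative D) (at x) \<longleftrightarrow> (g has_derivative D) (at x)" for D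
    using has_derivative_transform_within_open[OF _ assms(1,2)] assms(3) by metis
  then show ?thesis by (simp add: ddir_def frechet_derivative_def)
qed

lemma differentiable_cong_open:
  assumes "open S" "x \<in> S" "\<And>y. y \<in> S \<Longrightarrow> f y = g y" "f differentiable (at x)"
  shows "g differentiable (at x)"
  using has_derivative_transform_within_open[OF _ assms(1,2)] assms(3,4) unfolding differentiable_def by metis

lemma ddir_const: "ddir v (\<lambda>x. c) x = 0"
  by (rule ddir_eqI[of _ "\<lambda>_. 0"]) simp

lemma ddir_linear:
  assumes "bounded_linear L" shows "ddir v L x = L v"
  by (rule ddir_eqI) (rule bounded_linear_imp_has_derivative[OF assms])

lemma ddir_add:
  assumes "f differentiable (at x)" "g differentiable (at x)"
  shows "ddir v (\<lambda>x. f x + g x) x = ddir v f x + ddir v g x"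
  by (rule ddir_eqI) (intro has_derivative_add has_derivative_ddir assms)

lemma ddir_diff:
  assumes "f differentiable (at x)" "g differentiable (at x)"
  shows "ddir v (\<lambda>x. f x - g x) x = ddir v f x - ddir v g x"
  by (rule ddir_eqI) (intro has_derivative_diff has_derivative_ddir assms)

lemma ddir_mult:
  fixes f g :: "'a::real_normed_vector \<Rightarrow> real"
  assumes "f differentiable (at x)" "g differentiable (at x)"
  shows "ddir v (\<lambda>x. f x * g x) x = f x * ddir v g x + ddir v f x * g x"
  by (rule ddir_eqI) (intro has_derivative_mult has_derivative_ddir assms)

lemma ddir_compose:
  assumes "g differentiable (at x)" "f differentiable (at (g x))"
  shows "ddir v (\<lambda>x. f (g x)) x = ddir (ddir v g x) f (g x)"
  by (rule ddir_eqI)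
     (rule has_derivative_compose[OF has_derivative_ddir[OF assms(1)] has_derivative_ddir[OF assms(2)]])

lemma ddir_real:
  fixes f :: "real \<Rightarrow> real"
  assumes "(f has_real_derivative d) (at x)"
  shows "ddir v f x = d * v"
  by (rule ddir_eqI) (use assms in \<open>simp add: has_field_derivative_def\<close>)

lemma C_k_on_cong:
  assumes "open S" "\<And>x. x \<in> S \<Longrightarrow> f x = g x" "C_k_on k S f"
  shows "C_k_on k S g"
  using assms(2,3)
proof (induction k arbitrary: f g)
  case 0 then show ?case using continuous_on_cong by (metis C_k_on.simps(1))
next
  case (Suc k)
  have "g differentiable (at x)" if "x \<in> S" for x
    using differentiable_cong_open[OF assms(1) that, of f g] Suc.prems that by auto
  moreover have "C_k_on k S (ddir v g)" for v
    using Suc.IH[of "ddir v f" "ddir v g"] ddir_cong_open[OF assms(1), of _ f g] Suc.prems by auto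
  ultimately show ?case by simp
qed

lemma C_k_on_imp_continuous: "C_k_on k S f \<Longrightarrow> continuous_on S f"
  by (cases k) (auto intro!: continuous_at_imp_continuous_on differentiable_imp_continuous_within)

lemma C_k_on_Suc_imp: "C_k_on (Suc k) S f \<Longrightarrow> C_k_on k S f"
proof (induction k arbitrary: f)
  case 0 then show ?case by (metis C_k_on.simps(1) C_k_on_imp_continuous)
next
  case (Suc k) then show ?case by (metis C_k_on.simps(2))
qed

lemma C_k_on_const: "C_k_on k S (\<lambda>x. c)"
proof (induction k arbitrary: c)
  case (Suc k)
  then show ?case by (simp add: ddir_const[abs_def])
qed simp

lemma C_k_on_linear:
  assumes "bounded_linear L" shows "C_k_on k S L"
proof (cases k)
  case 0 then show ?thesis using assms by (simp add: linear_continuous_on)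
next
  case (Suc k)
  have "ddir v L = (\<lambda>x. L v)" for v by (auto simp: ddir_linear[OF assms])
  then show ?thesis using Suc assms by (simp add: C_k_on_const bounded_linear_imp_differentiable)
qed

lemma C_k_on_add:
  assumes "open S" "C_k_on k S f" "C_k_on k S g"
  shows "C_k_on k S (\<lambda>x. f x + g x)"
  using assms(2,3)
proof (induction k arbitrary: f g)
  case (Suc k)
  have "C_k_on k S (ddir v (\<lambda>x. f x + g x))" for v
    by (rule C_k_on_cong[OF assms(1), of "\<lambda>x. ddir v f x + ddir v g x"])
       (use Suc in \<open>auto simp: ddir_add\<close>)
  then show ?case using Suc by auto
qed (auto intro: continuous_intros)

text \<open>The product rule expresses a derivative of the product by products of functions of class one lower,
and \<open>C_k_on_Suc_imp\<close> lowers the class of the undifferentiated factors.\<close>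

lemma C_k_on_mult:
  fixes f g :: "_ \<Rightarrow> real"
  assumes "open S" "C_k_on k S f" "C_k_on k S g"
  shows "C_k_on k S (\<lambda>x. f x * g x)"
  using assms(2,3)
proof (induction k arbitrary: f g)
  case (Suc k)
  have "C_k_on k S (ddir v (\<lambda>x. f x * g x))" for v
  proof (rule C_k_on_cong[OF assms(1)])
    show "C_k_on k S (\<lambda>x. f x * ddir v g x + ddir v f x * g x)"
      using Suc.prems Suc.prems[THEN C_k_on_Suc_imp] by (intro C_k_on_add[OF assms(1)] Suc.IH) auto
  qed (use Suc in \<open>auto simp: ddir_mult\<close>)
  then show ?case using Suc by auto
qed (auto intro: continuous_intros)

text \<open>The outer function has a real argument, so the chain rule is a product of scalar functions and the induction
closes with \<open>C_k_on_mult\<close>.\<close>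

lemma C_k_on_compose:
  fixes f :: "real \<Rightarrow> real"
  assumes "open S" "open I" "g ` S \<subseteq> I" "C_k_on k I f" "C_k_on k S g"
  shows "C_k_on k S (\<lambda>x. f (g x))"
  using assms(3,4,5)
proof (induction k arbitrary: f)
  case 0 then show ?case
    by (auto intro: continuous_on_compose2)
next
  case (Suc k)
  have dg: "g differentiable (at x)" if "x \<in> S" for x using that Suc.prems by simp
  have df: "f differentiable (at (g x))" if "x \<in> S" for x using that Suc.prems by auto
  have "ddir v (\<lambda>x. f (g x)) x = ddir 1 f (g x) * ddir v g x" if "x \<in> S" for x v
  proof -
    have "ddir (ddir v g x) f (g x) = ddir v g x *\<^sub>R ddir 1 f (g x)"
      using linear_cmul[OF linear_ddir[OF df[OF that]], of "ddir v g x" 1] by simp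
    then show ?thesis using ddir_compose[OF dg[OF that] df[OF that]] by simp
  qed
  moreover have "C_k_on k S (\<lambda>x. ddir 1 f (g x) * ddir v g x)" for v
  proof (rule C_k_on_mult[OF assms(1)])
    show "C_k_on k S (\<lambda>x. ddir 1 f (g x))"
      by (rule Suc.IH[OF Suc.prems(1) _ C_k_on_Suc_imp[OF Suc.prems(3)]]) (use Suc.prems(2) in simp)
    show "C_k_on k S (ddir v g)" using Suc.prems(3) by simp
  qed
  ultimately have "C_k_on k S (ddir v (\<lambda>x. f (g x)))" for v
    using C_k_on_cong[OF assms(1), of "\<lambda>x. ddir 1 f (g x) * ddir v g x" "ddir v (\<lambda>x. f (g x))"]
    by simp
  moreover have "(\<lambda>x. f (g x)) differentiable (at x)" if "x \<in> S" for x
    using differentiable_chain_at[OF dg[OF that] df[OF that]] by (simp add: o_def)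
  ultimately show ?case by simp
qed

lemma C_k_on_Un:
  assumes "open S" "open S'" "C_k_on k S f" "C_k_on k S' f"
  shows "C_k_on k (S \<union> S') f"
  using assms(3,4)
  by (induction k arbitrary: f) (auto intro: continuous_on_open_Un assms)

lemma smooth_on_ddir: "smooth_on S f \<Longrightarrow> smooth_on S (ddir v f)"
  unfolding smooth_on_def by (metis C_k_on.simps(2))

lemma smooth_on_differentiable: "smooth_on S f \<Longrightarrow> x \<in> S \<Longrightarrow> f differentiable (at x)"
  unfolding smooth_on_def by (metis C_k_on.simps(2))

lemma smooth_on_continuous: "smooth_on S f \<Longrightarrow> continuous_on S f"
  unfolding smooth_on_def using C_k_on_imp_continuous by blast

text \<open>The derivative is a multiple of another power, so the induction runs over all exponents at once.\<close>

lemma C_k_on_powr: "C_k_on k {0<..} (\<lambda>x::real. x powr a)"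
proof (induction k arbitrary: a)
  case 0 show ?case by (auto intro!: continuous_intros)
next
  case (Suc k)
  have d: "((\<lambda>x. x powr a) has_real_derivative a * x powr (a - 1)) (at x)" if "x > 0" for x
    by (auto intro!: derivative_eq_intros simp: that)
  have "C_k_on k {0<..} (ddir v (\<lambda>x::real. x powr a))" for v
    by (rule C_k_on_cong[OF _ _ C_k_on_mult[OF _ C_k_on_const[of _ _ "a * v"] Suc[of "a - 1"]]])
       (auto simp: ddir_real[OF d])
  moreover have "(\<lambda>x. x powr a) differentiable (at x)" if "x > 0" for x
    using d[OF that] by (meson real_differentiable_def)
  ultimately show ?case by simp
qed

lemma C_k_on_ln: "C_k_on k {0<..} (ln :: real \<Rightarrow> real)"
proof (cases k)
  case 0 then show ?thesis by (auto intro!: continuous_intros)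
next
  case (Suc k)
  have d: "(ln has_real_derivative 1 / x) (at x)" if "x > 0" for x :: real
    using that by (auto intro!: derivative_eq_intros)
  have "C_k_on k {0<..} (ddir v (ln::real\<Rightarrow>real))" for v
    by (rule C_k_on_cong[OF _ _ C_k_on_mult[OF _ C_k_on_const[of _ _ "v"] C_k_on_powr[of _ "-1"]]])
       (auto simp: ddir_real[OF d] powr_minus divide_simps)
  moreover have "ln differentiable (at x)" if "x > 0" for x :: real
    using d[OF that] by (meson real_differentiable_def)
  ultimately show ?thesis using Suc by simp
qed

lemma C_k_on_subset: "C_k_on k S f \<Longrightarrow> S' \<subseteq> S \<Longrightarrow> C_k_on k S' f"
  by (induction k arbitrary: f) (auto intro: continuous_on_subset)

lemma smooth_on_mult:
  fixes f g :: "_ \<Rightarrow> real"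
  shows "open S \<Longrightarrow> smooth_on S f \<Longrightarrow> smooth_on S g \<Longrightarrow> smooth_on S (\<lambda>x. f x * g x)"
  by (simp add: smooth_on_def C_k_on_mult)

lemma smooth_on_compose:
  fixes f :: "real \<Rightarrow> real"
  shows "open S \<Longrightarrow> open I \<Longrightarrow> g ` S \<subseteq> I \<Longrightarrow> smooth_on I f \<Longrightarrow> smooth_on S g \<Longrightarrow> smooth_on S (\<lambda>x. f (g x))"
  by (simp add: smooth_on_def C_k_on_compose)

lemma smooth_on_cong:
  "open S \<Longrightarrow> smooth_on S f \<Longrightarrow> (\<And>x. x \<in> S \<Longrightarrow> f x = g x) \<Longrightarrow> smooth_on S g"
  using C_k_on_cong unfolding smooth_on_def by blast

lemma smooth_on_linear: "bounded_linear L \<Longrightarrow> smooth_on S L"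
  by (simp add: smooth_on_def C_k_on_linear)

lemma smooth_on_const: "smooth_on S (\<lambda>x. c)"
  by (simp add: smooth_on_def C_k_on_const)

lemma smooth_on_subset: "smooth_on S f \<Longrightarrow> S' \<subseteq> S \<Longrightarrow> smooth_on S' f"
  using C_k_on_subset unfolding smooth_on_def by blast

lemma smooth_on_Un:
  "open S \<Longrightarrow> open S' \<Longrightarrow> smooth_on S f \<Longrightarrow> smooth_on S' f \<Longrightarrow> smooth_on (S \<union> S') f"
  by (simp add: smooth_on_def C_k_on_Un)

section \<open>A smooth bump function\<close>

text \<open>For \<open>m = 0\<close> this is Cauchy's flat function. The factors \<open>x ^ m\<close> make the family closed under
differentiation up to linear combinations.\<close>

definition flat :: "nat \<Rightarrow> real \<Rightarrow> real" where
  "flat m x = (if x > 0 then exp (- (1 / x)) / x ^ m else 0)"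

lemma flat_tendsto: "(flat m \<longlongrightarrow> 0) (at_right 0)"
proof -
  have "((\<lambda>x. (1/x) ^ m / exp (1 / x)) \<longlongrightarrow> 0) (at_right (0::real))"
    by (rule filterlim_compose[OF tendsto_power_div_exp_0])
       (simp add: filterlim_inverse_at_top_right[unfolded inverse_eq_divide])
  then show ?thesis
    by (rule Lim_transform_eventually)
       (auto simp: flat_def eventually_at_filter exp_minus field_simps intro!: always_eventually)
qed

text \<open>At \<open>0\<close> the difference quotient from the right is \<open>flat (m + 1)\<close>, which tends to \<open>0\<close>.\<close>

lemma flat_has_derivative:
  "(flat m has_real_derivative (flat (m + 2) x - m * flat (m + 1) x)) (at x)"
proof -
  consider "x > 0" | "x < 0" | "x = 0" by linarith
  then show ?thesis
  proof cases
    case 1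
    have "((\<lambda>x. exp (- (1 / x)) / x ^ m) has_real_derivative (flat (m + 2) x - m * flat (m + 1) x)) (at x)"
    proof -
      have "((\<lambda>x. x ^ m) has_real_derivative real m * x ^ m / x) (at x)"
        using DERIV_pow[of m x] 1 by (cases m) auto
      moreover have "((\<lambda>x. exp (- (1 / x))) has_real_derivative exp (- (1 / x)) / x\<^sup>2) (at x)"
        using 1 by (auto intro!: derivative_eq_intros simp: power2_eq_square)
      ultimately have "((\<lambda>x. exp (- (1 / x)) / x ^ m) has_real_derivative
          (exp (- (1 / x)) / x\<^sup>2 * x ^ m - exp (- (1 / x)) * (real m * x ^ m / x)) / (x ^ m * x ^ m)) (at x)"
        using 1 by (intro DERIV_divide) auto
      then show ?thesis
        by (rule DERIV_cong) (use 1 in \<open>simp add: flat_def field_simps power2_eq_square\<close>)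
    qed
    then show ?thesis
      by (rule has_field_derivative_transform_within_open[of _ _ _ "{0<..}"]) (auto simp: flat_def 1)
  next
    case 2
    have "((\<lambda>x. 0) has_real_derivative (flat (m + 2) x - m * flat (m + 1) x)) (at x)"
      using 2 by (auto simp: flat_def)
    then show ?thesis
      by (rule has_field_derivative_transform_within_open[of _ _ _ "{..<0}"]) (auto simp: flat_def 2)
  next
    case 3
    have "((\<lambda>h. (flat m (0 + h) - flat m 0) / h) \<longlongrightarrow> 0) (at 0)"
    proof (rule filterlim_split_at)
      show "((\<lambda>h. (flat m (0 + h) - flat m 0) / h) \<longlongrightarrow> 0) (at_right 0)"
        by (rule Lim_transform_eventually[OF flat_tendsto[of "Suc m"]])
           (auto simp: flat_def eventually_at_filter field_simps)
      show "((\<lambda>h. (flat m (0 + h) - flat m 0) / h) \<longlongrightarrow> 0) (at_left 0)"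
        by (rule tendsto_eventually) (auto simp: flat_def eventually_at_filter)
    qed
    then show ?thesis using 3 by (simp add: DERIV_def flat_def)
  qed
qed

lemma C_k_on_flat: "C_k_on k UNIV (flat m)"
proof (induction k arbitrary: m)
  case 0 show ?case
    using flat_has_derivative by (auto intro!: continuous_at_imp_continuous_on DERIV_isCont)
next
  case (Suc k)
  have "C_k_on k UNIV (ddir v (flat m))" for v
    by (rule C_k_on_cong[OF _ _ C_k_on_mult[OF _ C_k_on_const[of _ _ v] C_k_on_add[OF _ Suc[of "m+2"]
              C_k_on_mult[OF _ C_k_on_const[of _ _ "- real m"] Suc[of "m+1"]]]]])
       (auto simp: ddir_real[OF flat_has_derivative] algebra_simps)
  moreover have "flat m differentiable (at x)" for x
    using flat_has_derivative by (meson real_differentiable_def)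
  ultimately show ?case by simp
qed

definition bump :: "real \<Rightarrow> real" where
  "bump x = flat 0 (1 - x * x)"

lemma bump_smooth: "smooth_on UNIV bump"
  unfolding smooth_on_def bump_def[abs_def]
proof
  fix k
  have l: "bounded_linear (\<lambda>x::real. - x)" by (rule bounded_linear_minus[OF bounded_linear_ident])
  have "C_k_on k UNIV (\<lambda>x::real. 1 + (- x) * x)"
    by (intro C_k_on_add C_k_on_mult C_k_on_const C_k_on_linear l bounded_linear_ident) auto
  then have "C_k_on k UNIV (\<lambda>x::real. 1 - x * x)" by simp
  from C_k_on_compose[OF _ _ _ C_k_on_flat this]
  show "C_k_on k UNIV (\<lambda>x. flat 0 (1 - x * x))" by auto
qed

lemma bump_eq_0: "\<bar>x\<bar> \<ge> 1 \<Longrightarrow> bump x = 0"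
proof -
  assume "\<bar>x\<bar> \<ge> 1"
  then have "1 \<le> \<bar>x\<bar> * \<bar>x\<bar>" using mult_mono'[of 1 "\<bar>x\<bar>" 1 "\<bar>x\<bar>"] by simp
  then show ?thesis by (simp add: bump_def flat_def abs_mult_self_eq)
qed

lemma bump_ge: "\<bar>x\<bar> \<le> 1/2 \<Longrightarrow> bump x \<ge> exp (- 2)"
proof -
  assume "\<bar>x\<bar> \<le> 1/2"
  then have "\<bar>x\<bar> * \<bar>x\<bar> \<le> 1/2 * (1/2)" by (intro mult_mono) auto
  then have "1 - x * x \<ge> 1/2" by (simp add: abs_mult_self_eq)
  then show ?thesis by (simp add: bump_def flat_def divide_simps)
qed

section \<open>Test functions on the half-plane\<close>

lemma open_half_plane: "open half_plane"
  unfolding half_plane_def by (intro open_Times) auto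

lemma half_plane_iff: "q \<in> half_plane \<longleftrightarrow> 0 < fst q"
  by (cases q) (auto simp: half_plane_def)

lemma smooth_on_powr_fst: "smooth_on half_plane (\<lambda>q. fst q powr a)"
  by (rule smooth_on_compose[OF open_half_plane, of "{0<..}" fst])
     (auto simp: half_plane_def smooth_on_def C_k_on_powr C_k_on_linear bounded_linear_fst)

lemma test_function_smooth: "test_function f \<Longrightarrow> smooth_on UNIV f"
  by (simp add: test_function_def)

lemma test_function_differentiable: "test_function f \<Longrightarrow> f differentiable (at q)"
  using smooth_on_differentiable test_function_smooth by blast

lemma test_function_zero: "test_function f \<Longrightarrow> q \<notin> half_plane \<Longrightarrow> f q = 0"
  using closure_subset[of "{q. f q \<noteq> 0}"] unfolding test_function_def by blast

text \<open>Smoothness on \<open>half_plane\<close> suffices for a compactly supported function: off the support it is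
locally zero, and the two open sets cover the plane.\<close>

lemma test_functionI:
  assumes "smooth_on half_plane f" "compact K" "K \<subseteq> half_plane" "\<And>q. q \<notin> K \<Longrightarrow> f q = 0"
  shows "test_function f"
proof -
  have "closed K" using assms by (simp add: compact_imp_closed)
  then have K: "closure {q. f q \<noteq> 0} \<subseteq> K" using assms(4) by (intro closure_minimal) auto
  have "smooth_on (- K) f"
    by (rule smooth_on_cong[OF _ smooth_on_const[of _ 0]]) (use \<open>closed K\<close> assms(4) in auto)
  then have "smooth_on (half_plane \<union> - K) f"
    using \<open>closed K\<close> by (intro smooth_on_Un open_half_plane assms(1)) auto
  moreover have "half_plane \<union> - K = UNIV" using assms(3) by auto
  moreover have "compact (closure {q. f q \<noteq> 0})"
    using K compact_Int_closed[OF assms(2), of "closure {q. f q \<noteq> 0}"] by (simp add: Int_absorb1)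
  ultimately show ?thesis using K assms(3) unfolding test_function_def by auto
qed

lemma test_function_support:
  assumes "test_function f"
  obtains K where "compact K" "K \<subseteq> half_plane" "\<And>q. q \<notin> K \<Longrightarrow> f q = 0"
proof (rule that)
  show "compact (closure {q. f q \<noteq> 0})" "closure {q. f q \<noteq> 0} \<subseteq> half_plane"
    using assms by (simp_all add: test_function_def)
  show "f q = 0" if "q \<notin> closure {q. f q \<noteq> 0}" for q
    using closure_subset[of "{q. f q \<noteq> 0}"] that by blast
qed

text \<open>Multipliers such as powers of \<open>r\<close>, singular on the axis, keep test functions smooth on the whole plane.
This makes every integrand below a test function, so that integrability is never an issue.\<close>

lemma test_function_smooth_mult:
  assumes "smooth_on half_plane w" "test_function f"
  shows "test_function (\<lambda>q. w q * f q)"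
proof -
  obtain K where "compact K" "K \<subseteq> half_plane" "\<And>q. q \<notin> K \<Longrightarrow> f q = 0"
    using test_function_support[OF assms(2)] by blast
  then show ?thesis
    using smooth_on_mult[OF open_half_plane assms(1) smooth_on_subset[OF test_function_smooth[OF assms(2)]]]
    by (intro test_functionI[of _ K]) auto
qed

lemma test_function_mult: "test_function f \<Longrightarrow> test_function g \<Longrightarrow> test_function (\<lambda>q. f q * g q)"
  by (rule test_function_smooth_mult) (auto intro: smooth_on_subset[OF test_function_smooth])

lemma test_function_power2: "test_function f \<Longrightarrow> test_function (\<lambda>q. (f q)\<^sup>2)"
  by (simp add: power2_eq_square test_function_mult)

lemma test_function_cmult: "test_function f \<Longrightarrow> test_function (\<lambda>q. c * f q)"
  by (rule test_function_smooth_mult[OF smooth_on_const])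

lemma test_function_powr: "test_function f \<Longrightarrow> test_function (\<lambda>q. fst q powr a * f q)"
  by (rule test_function_smooth_mult[OF smooth_on_powr_fst])

lemma test_function_div_fst:
  assumes "test_function f" shows "test_function (\<lambda>q. f q / fst q)"
proof -
  have "f q / fst q = fst q powr -1 * f q" for q
    using test_function_zero[OF assms, of q]
    by (cases "q \<in> half_plane") (auto simp: half_plane_def powr_minus divide_simps)
  then show ?thesis using test_function_powr[OF assms, of "-1"] by presburger
qed

lemma test_function_mult_fst: "test_function f \<Longrightarrow> test_function (\<lambda>q. fst q * f q)"
  by (rule test_function_smooth_mult[OF smooth_on_linear[OF bounded_linear_fst]])

lemma test_function_add:
  assumes "test_function f" "test_function g"
  shows "test_function (\<lambda>q. f q + g q)"
proof -
  obtain K L where "compact K" "K \<subseteq> half_plane" "\<And>q. q \<notin> K \<Longrightarrow> f q = 0"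
     "compact L" "L \<subseteq> half_plane" "\<And>q. q \<notin> L \<Longrightarrow> g q = 0"
    using assms[THEN test_function_support] by metis
  moreover have "smooth_on UNIV (\<lambda>q. f q + g q)"
    using assms[THEN test_function_smooth] by (simp add: smooth_on_def C_k_on_add)
  ultimately show ?thesis
    by (intro test_functionI[of _ "K \<union> L"]) (auto intro: smooth_on_subset)
qed

lemma test_function_minus: "test_function f \<Longrightarrow> test_function g \<Longrightarrow> test_function (\<lambda>q. f q - g q)"
  using test_function_add[of f "\<lambda>q. -1 * g q"] test_function_cmult[of g "-1"] by simp

lemma test_function_ddir:
  assumes "test_function f" shows "test_function (ddir v f)"
proof -
  obtain K where K: "compact K" "K \<subseteq> half_plane" "\<And>q. q \<notin> K \<Longrightarrow> f q = 0"
    using test_function_support[OF assms] by blast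
  have "ddir v f q = 0" if "q \<notin> K" for q
    using ddir_cong_open[of "- K" q f "\<lambda>_. 0" v] K that by (simp add: compact_imp_closed open_Compl ddir_const)
  then show ?thesis
    using K smooth_on_subset[OF smooth_on_ddir[OF test_function_smooth[OF assms]]]
    by (intro test_functionI[of _ K]) auto
qed

lemmas test_function_intros = test_function_add test_function_minus test_function_mult test_function_power2
  test_function_cmult test_function_powr test_function_div_fst test_function_mult_fst test_function_ddir

section \<open>Weighted integrals and the divergence theorem\<close>

lemma test_function_integrable:
  assumes "test_function f" shows "integrable lborel f"
proof -
  obtain K where K: "compact K" "\<And>q. q \<notin> K \<Longrightarrow> f q = 0"
    using test_function_support[OF assms] by metis
  have "integrable lborel (\<lambda>x. indicator K x *\<^sub>R f x)"
    using smooth_on_continuous[OF test_function_smooth[OF assms]]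
    by (intro borel_integrable_compact K(1)) (auto intro: continuous_on_subset)
  moreover have "(\<lambda>x. indicator K x *\<^sub>R f x) = f"
  proof
    show "indicator K x *\<^sub>R f x = f x" for x using K(2)[of x] by (cases "x \<in> K") auto
  qed
  ultimately show ?thesis by simp
qed

lemma integral_mu_cong: "(\<And>q. q \<in> half_plane \<Longrightarrow> f q = g q) \<Longrightarrow> integral_mu \<alpha> f = integral_mu \<alpha> g"
  unfolding integral_mu_def set_lebesgue_integral_def
  by (rule Bochner_Integration.integral_cong) (auto simp: indicator_def)

lemma integral_mu_test:
  assumes "test_function f"
  shows "integral_mu \<alpha> f = (\<integral>q. fst q powr \<alpha> * f q \<partial>lborel)"
  unfolding integral_mu_def set_lebesgue_integral_def
  by (rule Bochner_Integration.integral_cong) (use test_function_zero[OF assms] in \<open>auto simp: indicator_def\<close>)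

lemma integral_mu_add:
  "test_function f \<Longrightarrow> test_function g \<Longrightarrow> integral_mu \<alpha> (\<lambda>q. f q + g q) = integral_mu \<alpha> f + integral_mu \<alpha> g"
  by (simp add: integral_mu_test test_function_add distrib_left test_function_integrable test_function_powr)

lemma integral_mu_cmult: "integral_mu \<alpha> (\<lambda>q. c * f q) = c * integral_mu \<alpha> f"
  unfolding integral_mu_def set_lebesgue_integral_def by (simp add: mult.assoc mult.left_commute)

lemma integral_mu_minus:
  "test_function f \<Longrightarrow> test_function g \<Longrightarrow> integral_mu \<alpha> (\<lambda>q. f q - g q) = integral_mu \<alpha> f - integral_mu \<alpha> g"
  using integral_mu_add[of f "\<lambda>q. -1 * g q"] integral_mu_cmult[of \<alpha> "-1" g] test_function_cmult[of g "-1"] by simp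

lemma integral_mu_powr: "integral_mu \<alpha> (\<lambda>q. fst q powr \<beta> * f q) = integral_mu (\<alpha> + \<beta>) f"
  unfolding integral_mu_def set_lebesgue_integral_def
  by (rule Bochner_Integration.integral_cong) (auto simp: indicator_def powr_add mult_ac)

lemma integral_derivative_eq_0:
  fixes f :: "real \<Rightarrow> real"
  assumes "\<And>x. (f has_real_derivative f' x) (at x)" "continuous_on UNIV f'" "\<And>x. \<bar>x\<bar> \<ge> K \<Longrightarrow> f x = 0" "K > 0"
  shows "(\<integral>x. f' x \<partial>lborel) = 0"
proof -
  have "f' x = 0" if "\<bar>x\<bar> > K" for x
  proof -
    have "open {x. \<bar>x\<bar> > K}" by (intro open_Collect_less continuous_intros)
    with that assms(3) have "((\<lambda>x. 0) has_real_derivative f' x) (at x)"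
      by (intro has_field_derivative_transform_within_open[OF assms(1), where S = "{x. \<bar>x\<bar> > K}"]) auto
    then show ?thesis using DERIV_unique DERIV_const by blast
  qed
  then have "f' x * indicator {-K..K} x = f' x" for x by (cases "\<bar>x\<bar> > K") (auto simp: indicator_def)
  then have "(\<lambda>x. f' x * indicator {-K..K} x) = f'" by (rule ext)
  then show ?thesis
    using integral_FTC_Icc_real[of "-K" K f f'] assms by (simp add: continuous_on_eq_continuous_at)
qed

lemma lborel_Fubini:
  fixes f :: "real \<times> real \<Rightarrow> real"
  assumes "integrable lborel f"
  shows "(\<integral>q. f q \<partial>lborel) = (\<integral>z. (\<integral>r. f (r, z) \<partial>lborel) \<partial>lborel)"
    and "(\<integral>q. f q \<partial>lborel) = (\<integral>r. (\<integral>z. f (r, z) \<partial>lborel) \<partial>lborel)"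
proof -
  have i: "integrable (lborel \<Otimes>\<^sub>M lborel) (case_prod (\<lambda>r z. f (r, z)))" using assms by (simp add: lborel_prod)
  show "(\<integral>q. f q \<partial>lborel) = (\<integral>z. (\<integral>r. f (r, z) \<partial>lborel) \<partial>lborel)"
    using lborel_pair.integral_snd[OF i] by (simp add: lborel_prod)
  show "(\<integral>q. f q \<partial>lborel) = (\<integral>r. (\<integral>z. f (r, z) \<partial>lborel) \<partial>lborel)"
    using lborel_pair.integral_fst[OF i] by (simp add: lborel_prod)
qed

lemma ddir_line:
  fixes f :: "'a::real_normed_vector \<Rightarrow> real"
  assumes "f differentiable (at (a + s *\<^sub>R v))"
  shows "((\<lambda>s. f (a + s *\<^sub>R v)) has_real_derivative ddir v f (a + s *\<^sub>R v)) (at s)"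
proof -
  have "((\<lambda>s. f (a + s *\<^sub>R v)) has_derivative (\<lambda>h. ddir (h *\<^sub>R v) f (a + s *\<^sub>R v))) (at s)"
    by (rule has_derivative_compose[where f = "\<lambda>s. a + s *\<^sub>R v", OF _ has_derivative_ddir[OF assms]])
       (auto intro!: derivative_eq_intros)
  moreover have "(\<lambda>h. ddir (h *\<^sub>R v) f (a + s *\<^sub>R v)) = (\<lambda>h. ddir v f (a + s *\<^sub>R v) * h)"
    by (rule ext) (simp only: linear_cmul[OF linear_ddir[OF assms]] real_scaleR_def mult.commute)
  ultimately show ?thesis by (simp add: has_field_derivative_def)
qed

lemma integral_ddir_eq_0:
  assumes "test_function f"
  shows "(\<integral>q. D_r f q \<partial>lborel) = 0" "(\<integral>q. D_z f q \<partial>lborel) = 0"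
proof -
  obtain K where K: "compact K" "\<And>q. q \<notin> K \<Longrightarrow> f q = 0"
    using test_function_support[OF assms] by metis
  obtain B where B: "B > 0" "\<And>q. q \<in> K \<Longrightarrow> norm q < B"
    using compact_imp_bounded[OF K(1)] bounded_pos_less by metis
  have z: "f (r, z) = 0" if "\<bar>r\<bar> \<ge> B \<or> \<bar>z\<bar> \<ge> B" for r z
  proof -
    have "\<bar>r\<bar> \<le> norm (r, z)" "\<bar>z\<bar> \<le> norm (r, z)"
      by (simp_all add: norm_prod_def real_le_rsqrt)
    then show ?thesis using K(2) B(2) that by force
  qed
  have c: "continuous_on UNIV (ddir v f)" for v
    by (rule smooth_on_continuous[OF smooth_on_ddir[OF test_function_smooth[OF assms]]])
  have "((\<lambda>r. f (r, z)) has_real_derivative D_r f (r, z)) (at r)" for r z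
    using ddir_line[OF test_function_differentiable[OF assms], of "(0, z)" "(1, 0)" r] by simp
  moreover have "continuous_on UNIV (\<lambda>r. D_r f (r, z))" for z
    by (rule continuous_on_compose2[OF c]) (auto intro!: continuous_intros)
  ultimately have "(\<integral>r. D_r f (r, z) \<partial>lborel) = 0" for z
    using z B(1) by (intro integral_derivative_eq_0[of "\<lambda>r. f (r, z)" _ B]) auto
  then show "(\<integral>q. D_r f q \<partial>lborel) = 0"
    using lborel_Fubini(1)[OF test_function_integrable[OF test_function_ddir[OF assms]]] by simp
  have "((\<lambda>z. f (r, z)) has_real_derivative D_z f (r, z)) (at z)" for r z
    using ddir_line[OF test_function_differentiable[OF assms], of "(r, 0)" "(0, 1)" z] by simp
  moreover have "continuous_on UNIV (\<lambda>z. D_z f (r, z))" for r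
    by (rule continuous_on_compose2[OF c]) (auto intro!: continuous_intros)
  ultimately have "(\<integral>z. D_z f (r, z) \<partial>lborel) = 0" for r
    using z B(1) by (intro integral_derivative_eq_0[of "\<lambda>z. f (r, z)" _ B]) auto
  then show "(\<integral>q. D_z f q \<partial>lborel) = 0"
    using lborel_Fubini(2)[OF test_function_integrable[OF test_function_ddir[OF assms]]] by simp
qed

lemma ddir_powr_fst:
  assumes "q \<in> half_plane"
  shows "ddir v (\<lambda>q. fst q powr a) q = a * fst q powr (a - 1) * fst v"
  by (rule ddir_eqI) (use assms in \<open>auto intro!: derivative_eq_intros simp: half_plane_def powr_diff\<close>)

lemma differentiable_powr_fst: "q \<in> half_plane \<Longrightarrow> (\<lambda>q. fst q powr a) differentiable (at q)"
  using smooth_on_differentiable[OF smooth_on_powr_fst] .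

lemma integral_mu_0:
  assumes "test_function k" shows "integral_mu 0 k = (\<integral>q. k q \<partial>lborel)"
  unfolding integral_mu_test[OF assms]
  by (rule Bochner_Integration.integral_cong)
     (use test_function_zero[OF assms] in \<open>auto simp: half_plane_def powr_def\<close>)

text \<open>The integrand is the divergence with respect to \<open>\<mu>\<^sub>\<alpha>\<close>, that is, \<open>r powr - \<alpha>\<close> times the flat
divergence of \<open>r powr \<alpha> * (f, g)\<close>. The latter field has compact support.\<close>

lemma integral_mu_divergence:
  assumes "test_function f" "test_function g"
  shows "integral_mu \<alpha> (\<lambda>q. D_r f q + \<alpha> / fst q * f q + D_z g q) = 0"
proof -
  let ?p = "\<lambda>q. fst q powr \<alpha>"
  have e: "fst q powr -\<alpha> * (D_r (\<lambda>q. ?p q * f q) q + D_z (\<lambda>q. ?p q * g q) q)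
     = D_r f q + \<alpha> / fst q * f q + D_z g q" if "q \<in> half_plane" for q
  proof -
    have "fst q > 0" using that by (auto simp: half_plane_def)
    then show ?thesis
      by (simp add: ddir_mult differentiable_powr_fst[OF that] test_function_differentiable assms
          ddir_powr_fst[OF that] powr_diff powr_minus field_simps)
  qed
  have t: "test_function (D_r (\<lambda>q. ?p q * f q))" "test_function (D_z (\<lambda>q. ?p q * g q))"
    by (intro test_function_intros assms)+
  have "integral_mu \<alpha> (\<lambda>q. D_r f q + \<alpha> / fst q * f q + D_z g q)
    = integral_mu \<alpha> (\<lambda>q. fst q powr -\<alpha> * (D_r (\<lambda>q. ?p q * f q) q + D_z (\<lambda>q. ?p q * g q) q))"
    by (rule integral_mu_cong) (simp only: e)
  also have "\<dots> = integral_mu 0 (\<lambda>q. D_r (\<lambda>q. ?p q * f q) q + D_z (\<lambda>q. ?p q * g q) q)"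
    by (simp only: integral_mu_powr) simp
  also have "\<dots> = integral_mu 0 (D_r (\<lambda>q. ?p q * f q)) + integral_mu 0 (D_z (\<lambda>q. ?p q * g q))"
    by (rule integral_mu_add[OF t])
  also have "\<dots> = (\<integral>q. D_r (\<lambda>q. ?p q * f q) q \<partial>lborel) + (\<integral>q. D_z (\<lambda>q. ?p q * g q) q \<partial>lborel)"
    by (simp only: integral_mu_0[OF t(1)] integral_mu_0[OF t(2)])
  also have "\<dots> = 0"
    by (simp only: integral_ddir_eq_0 test_function_powr assms)
  finally show ?thesis .
qed

section \<open>Hardy's identity\<close>

text \<open>Expanding the first square in the remainder gives the cross term \<open>\<kappa> h h\<^sub>r / r\<close>, where \<open>\<kappa> = \<alpha> - 1\<close>. Up to
a multiple of \<open>h\<^sup>2 / r\<^sup>2\<close> it is the divergence of the radial field \<open>\<kappa> / 2 * h\<^sup>2 / r\<close> with respect to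
\<open>\<mu>\<^sub>\<alpha>\<close>, which integrates to zero.\<close>

lemma Hardy_identity:
  assumes h: "test_function h"
  shows "gradient_energy \<alpha> h = ((\<alpha> - 1) / 2)\<^sup>2 * integral_mu (\<alpha> - 2) (\<lambda>q. (h q)\<^sup>2)
    + integral_mu \<alpha> (\<lambda>q. (D_r h q + (\<alpha> - 1) / 2 * h q / fst q)\<^sup>2 + (D_z h q)\<^sup>2)"
proof -
  let ?k = "(\<alpha> - 1) / 2"
  let ?g = "\<lambda>q. (h q)\<^sup>2 / fst q"
  let ?P = "\<lambda>q. (h q / fst q)\<^sup>2"
  let ?R = "\<lambda>q. (D_r h q + ?k * h q / fst q)\<^sup>2 + (D_z h q)\<^sup>2"
  \<comment> \<open>The divergence of the field \<open>(?g, 0)\<close>, the zero being written as a test function.\<close>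
  let ?Z = "\<lambda>q. D_r ?g q + \<alpha> / fst q * ?g q + D_z (\<lambda>q. 0 * h q) q"
  have t0: "test_function (\<lambda>q. 0 * h q)" and tg: "test_function ?g" and tP: "test_function ?P"
    by (intro test_function_intros h)+
  have "test_function (\<lambda>q. (D_r h q + ?k * (h q / fst q))\<^sup>2 + (D_z h q)\<^sup>2)"
    by (intro test_function_intros h)
  then have tR: "test_function ?R" by simp
  have "test_function (\<lambda>q. D_r ?g q + \<alpha> * (?g q / fst q) + D_z (\<lambda>q. 0 * h q) q)"
    by (intro test_function_intros h)
  then have tZ: "test_function ?Z" by simp
  have Dg: "D_r ?g q = 2 * h q * D_r h q / fst q - (h q)\<^sup>2 / (fst q)\<^sup>2" if "q \<in> half_plane" for q
  proof -
    have "fst q > 0" using that by (auto simp: half_plane_def)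
    then have "(?g has_derivative
       (\<lambda>v. (2 * h q * ddir v h q * fst q - (h q)\<^sup>2 * fst v) / (fst q)\<^sup>2)) (at q)"
      by (auto intro!: derivative_eq_intros has_derivative_ddir test_function_differentiable h
            simp: power2_eq_square field_simps)
    from ddir_eqI[OF this, of "(1, 0)"] show ?thesis using \<open>fst q > 0\<close>
      by (simp add: power2_eq_square field_simps)
  qed
  have e: "(D_r h q)\<^sup>2 + (D_z h q)\<^sup>2 = ?k\<^sup>2 * ?P q + (?R q - ?k * ?Z q)" if "q \<in> half_plane" for q
  proof -
    have "fst q > 0" using that by (auto simp: half_plane_def)
    then show ?thesis
      unfolding Dg[OF that] by (simp add: ddir_const power2_eq_square field_simps)
  qed
  have "gradient_energy \<alpha> h = integral_mu \<alpha> (\<lambda>q. ?k\<^sup>2 * ?P q + (?R q - ?k * ?Z q))"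
    unfolding gradient_energy_def by (rule integral_mu_cong) (rule e)
  also have "\<dots> = integral_mu \<alpha> (\<lambda>q. ?k\<^sup>2 * ?P q) + integral_mu \<alpha> (\<lambda>q. ?R q - ?k * ?Z q)"
    by (intro integral_mu_add test_function_cmult test_function_minus tP tR tZ)
  also have "integral_mu \<alpha> (\<lambda>q. ?R q - ?k * ?Z q) = integral_mu \<alpha> ?R - integral_mu \<alpha> (\<lambda>q. ?k * ?Z q)"
    by (intro integral_mu_minus test_function_cmult tR tZ)
  also have "integral_mu \<alpha> (\<lambda>q. ?k\<^sup>2 * ?P q) = ?k\<^sup>2 * integral_mu \<alpha> ?P"
    by (rule integral_mu_cmult)
  also have "integral_mu \<alpha> (\<lambda>q. ?k * ?Z q) = ?k * integral_mu \<alpha> ?Z"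
    by (rule integral_mu_cmult)
  also have "integral_mu \<alpha> ?Z = 0" by (rule integral_mu_divergence[OF tg t0])
  also have "integral_mu \<alpha> ?P = integral_mu \<alpha> (\<lambda>q. fst q powr -2 * (h q)\<^sup>2)"
    by (rule integral_mu_cong) (auto simp: half_plane_def powr_minus divide_simps)
  also have "\<dots> = integral_mu (\<alpha> - 2) (\<lambda>q. (h q)\<^sup>2)"
    using integral_mu_powr[of \<alpha> "-2"] by simp
  finally show ?thesis by simp
qed

section \<open>Logarithmic cutoffs\<close>

lemma ln_le_iff_le_exp: "x > 0 \<Longrightarrow> ln x \<le> y \<longleftrightarrow> x \<le> exp (y::real)"
  by (metis exp_gt_zero exp_ln ln_exp ln_le_cancel_iff)

text \<open>Scaling in \<open>ln r\<close> rather than \<open>r\<close> is what makes the radial energy \<open>\<integral>w\<^sub>r\<^sup>2 r dr\<close> small: this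
energy and the mass \<open>\<integral>w\<^sup>2 / r dr\<close> scale like \<open>\<epsilon>\<close> and \<open>1 / \<epsilon>\<close>.\<close>

definition cutoff :: "real \<Rightarrow> real \<Rightarrow> real \<times> real \<Rightarrow> real" where
  "cutoff \<epsilon> \<delta> q = (if fst q > 0 then bump (\<epsilon> * ln (fst q)) * bump (\<delta> * snd q) else 0)"

lemma test_function_cutoff:
  assumes "\<epsilon> > 0" "\<delta> > 0"
  shows "test_function (cutoff \<epsilon> \<delta>)"
proof (rule test_functionI)
  show "smooth_on half_plane (cutoff \<epsilon> \<delta>)"
  proof (rule smooth_on_cong[OF open_half_plane])
    have "smooth_on half_plane (\<lambda>q. \<epsilon> * ln (fst q))"
      by (intro smooth_on_mult smooth_on_const open_half_plane
           smooth_on_compose[OF open_half_plane, of "{0<..}" fst ln])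
         (auto simp: half_plane_def smooth_on_def C_k_on_ln C_k_on_linear bounded_linear_fst)
    note r = this
    have z: "smooth_on half_plane (\<lambda>q. \<delta> * snd q)"
      by (intro smooth_on_mult smooth_on_const open_half_plane smooth_on_linear bounded_linear_snd)
    note bump_compose = smooth_on_compose[OF open_half_plane open_UNIV subset_UNIV bump_smooth]
    show "smooth_on half_plane (\<lambda>q. bump (\<epsilon> * ln (fst q)) * bump (\<delta> * snd q))"
      by (rule smooth_on_mult[OF open_half_plane bump_compose[OF r] bump_compose[OF z]])
  qed (auto simp: cutoff_def half_plane_def)
  let ?K = "{exp (- (1 / \<epsilon>))..exp (1 / \<epsilon>)} \<times> {- (1 / \<delta>)..1 / \<delta>}"
  show "compact ?K" by (intro compact_Times compact_Icc)
  show "?K \<subseteq> half_plane" by (auto simp: half_plane_def intro: less_le_trans[OF exp_gt_zero])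
  show "cutoff \<epsilon> \<delta> q = 0" if "q \<notin> ?K" for q
  proof (rule ccontr)
    assume "cutoff \<epsilon> \<delta> q \<noteq> 0"
    then have "fst q > 0" "bump (\<epsilon> * ln (fst q)) \<noteq> 0" "bump (\<delta> * snd q) \<noteq> 0"
      by (auto simp: cutoff_def split: if_splits)
    then have q: "fst q > 0" "\<bar>\<epsilon> * ln (fst q)\<bar> < 1" "\<bar>\<delta> * snd q\<bar> < 1"
      using bump_eq_0 not_less by blast+
    then have "- (1 / \<epsilon>) \<le> ln (fst q)" "ln (fst q) \<le> 1 / \<epsilon>" "- (1 / \<delta>) \<le> snd q" "snd q \<le> 1 / \<delta>"
      using assms by (auto simp: abs_less_iff field_simps)
    then show False using that q(1) by (cases q) (auto simp: ln_ge_iff ln_le_iff_le_exp)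
  qed
qed

abbreviation bump' :: "real \<Rightarrow> real" where "bump' \<equiv> ddir 1 bump"

lemma bump'_smooth: "smooth_on UNIV bump'"
  by (rule smooth_on_ddir[OF bump_smooth])

lemma bump'_eq_0: assumes "\<bar>x\<bar> > 1" shows "bump' x = 0"
proof -
  have "open {x::real. \<bar>x\<bar> > 1}" by (intro open_Collect_less continuous_intros)
  then show ?thesis
    using ddir_cong_open[of "{x. \<bar>x\<bar> > 1}" x bump "\<lambda>_. 0" 1] assms bump_eq_0 by (simp add: ddir_const)
qed

lemma has_derivative_bump: "(bump has_real_derivative bump' x) (at x)"
  using ddir_line[of bump 0 x 1] smooth_on_differentiable[OF bump_smooth, of x] by simp

lemma has_derivative_cutoff:
  assumes "q \<in> half_plane"
  shows "(cutoff \<epsilon> \<delta> has_derivative (\<lambda>v. \<epsilon> * bump' (\<epsilon> * ln (fst q)) / fst q * bump (\<delta> * snd q) * fst v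
     + \<delta> * bump (\<epsilon> * ln (fst q)) * bump' (\<delta> * snd q) * snd v)) (at q)"
proof (rule has_derivative_transform_within_open[OF _ open_half_plane assms])
  note b = DERIV_compose_FDERIV[OF has_derivative_bump]
  show "((\<lambda>q. bump (\<epsilon> * ln (fst q)) * bump (\<delta> * snd q)) has_derivative (\<lambda>v. \<epsilon> * bump' (\<epsilon> * ln (fst q)) / fst q * bump (\<delta> * snd q) * fst v
     + \<delta> * bump (\<epsilon> * ln (fst q)) * bump' (\<delta> * snd q) * snd v)) (at q)"
    by (rule derivative_eq_intros b refl | use assms in \<open>force simp: half_plane_def field_simps\<close>)+
qed (auto simp: cutoff_def half_plane_def)

lemma ddir_cutoff:
  assumes "q \<in> half_plane"
  shows "D_r (cutoff \<epsilon> \<delta>) q = \<epsilon> * bump' (\<epsilon> * ln (fst q)) / fst q * bump (\<delta> * snd q)"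
    "D_z (cutoff \<epsilon> \<delta>) q = \<delta> * bump (\<epsilon> * ln (fst q)) * bump' (\<delta> * snd q)"
  by (simp_all add: ddir_eqI[OF has_derivative_cutoff[OF assms]])

lemma integral_mu_product:
  assumes "test_function k" "\<And>q. q \<in> half_plane \<Longrightarrow> k q = a (fst q) * b (snd q)"
  shows "integral_mu \<beta> k = (\<integral>r. (if r > 0 then r powr \<beta> * a r else 0) \<partial>lborel) * (\<integral>z. b z \<partial>lborel)"
proof -
  let ?a = "\<lambda>r. if r > 0 then r powr \<beta> * a r else 0"
  have k: "fst q powr \<beta> * k q = ?a (fst q) * b (snd q)" for q
    using assms(2)[of q] test_function_zero[OF assms(1), of q] by (auto simp: half_plane_iff)
  have "integral_mu \<beta> k = (\<integral>r. (\<integral>z. fst (r, z) powr \<beta> * k (r, z) \<partial>lborel) \<partial>lborel)"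
    unfolding integral_mu_test[OF assms(1)]
    by (rule lborel_Fubini(2)[OF test_function_integrable[OF test_function_powr[OF assms(1)]]])
  moreover have "fst (r, z) powr \<beta> * k (r, z) = ?a r * b z" for r z using k[of "(r, z)"] by simp
  ultimately show ?thesis by (simp only: integral_mult_right_zero integral_mult_left_zero)
qed

text \<open>If \<open>P\<close> is a primitive of \<open>f\<close>, then \<open>P (\<epsilon> * ln r) / \<epsilon>\<close> is one of the left integrand, and both integrals
equal the increment of \<open>P\<close> across the support.\<close>

lemma integral_log_substitution:
  fixes f :: "real \<Rightarrow> real"
  assumes f: "continuous_on UNIV f" "\<And>x. \<bar>x\<bar> > K \<Longrightarrow> f x = 0" and "\<epsilon> > 0" "K > 0"
  shows "(\<integral>r. (if r > 0 then f (\<epsilon> * ln r) / r else 0) \<partial>lborel) = (\<integral>x. f x \<partial>lborel) / \<epsilon>"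
proof -
  \<comment> \<open>A primitive of \<open>f\<close> on an interval that contains the support.\<close>
  obtain P where P: "(P has_vector_derivative f x) (at x within {-K..K})" if "x \<in> {-K..K}" for x
    using antiderivative_continuous[OF continuous_on_subset[OF f(1)]] by (metis subset_UNIV)
  have 1: "(\<integral>x. indicator {-K..K} x *\<^sub>R f x \<partial>lborel) = P K - P (- K)"
    by (rule integral_FTC_Icc) (use assms P in \<open>auto intro: continuous_on_subset\<close>)
  let ?a = "exp (- (K / \<epsilon>))" and ?b = "exp (K / \<epsilon>)"
  have in_ab: "r \<in> {?a..?b} \<longleftrightarrow> r > 0 \<and> \<epsilon> * ln r \<in> {-K..K}" for r
  proof
    assume "r \<in> {?a..?b}"
    moreover then have "r > 0" using less_le_trans[OF exp_gt_zero, of _ r] by auto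
    ultimately show "r > 0 \<and> \<epsilon> * ln r \<in> {-K..K}" using \<open>\<epsilon> > 0\<close>
      by (auto simp flip: ln_ge_iff ln_le_iff_le_exp simp: field_simps)
  next
    assume "r > 0 \<and> \<epsilon> * ln r \<in> {-K..K}"
    then show "r \<in> {?a..?b}" using \<open>\<epsilon> > 0\<close>
      by (auto simp: ln_ge_iff[symmetric] ln_le_iff_le_exp[symmetric] field_simps)
  qed
  have 2: "(\<integral>r. indicator {?a..?b} r *\<^sub>R (\<epsilon> / r * f (\<epsilon> * ln r)) \<partial>lborel) = P (\<epsilon> * ln ?b) - P (\<epsilon> * ln ?a)"
  proof (rule integral_FTC_Icc)
    show "?a \<le> ?b" using assms by simp
    show "continuous_on {?a..?b} (\<lambda>r. \<epsilon> / r * f (\<epsilon> * ln r))"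
      by (intro continuous_intros continuous_on_compose2[OF f(1)]) (use in_ab in auto)
    fix r assume r: "?a \<le> r" "r \<le> ?b"
    then have r': "r > 0" "\<epsilon> * ln r \<in> {-K..K}" using in_ab[of r] by auto
    have "((\<lambda>r. \<epsilon> * ln r) has_vector_derivative \<epsilon> / r) (at r within {?a..?b})"
      unfolding has_real_derivative_iff_has_vector_derivative[symmetric]
      using r' by (auto intro!: derivative_eq_intros)
    moreover have "(P has_vector_derivative f (\<epsilon> * ln r)) (at (\<epsilon> * ln r) within (\<lambda>r. \<epsilon> * ln r) ` {?a..?b})"
      using in_ab by (intro has_vector_derivative_within_subset[OF P[OF r'(2)]]) blast
    ultimately show "((\<lambda>r. P (\<epsilon> * ln r)) has_vector_derivative \<epsilon> / r * f (\<epsilon> * ln r)) (at r within {?a..?b})"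
      using vector_diff_chain_within by (fastforce simp: o_def)
  qed
  have "(if r > 0 then f (\<epsilon> * ln r) / r else 0) = indicator {?a..?b} r *\<^sub>R (\<epsilon> / r * f (\<epsilon> * ln r)) / \<epsilon>" for r
  proof (cases "r \<in> {?a..?b}")
    case True then show ?thesis using in_ab[of r] \<open>\<epsilon> > 0\<close> by (simp add: indicator_def)
  next
    case False
    then have "r > 0 \<Longrightarrow> f (\<epsilon> * ln r) = 0" using in_ab[of r] by (intro f(2)) auto
    with False \<open>\<epsilon> > 0\<close> show ?thesis by (simp add: indicator_def)
  qed
  then have "(\<integral>r. (if r > 0 then f (\<epsilon> * ln r) / r else 0) \<partial>lborel) = (P K - P (- K)) / \<epsilon>"
    by (simp only: integral_divide_zero 2) (use \<open>\<epsilon> > 0\<close> in simp)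
  moreover have "indicator {-K..K} x *\<^sub>R f x = f x" for x
    using f(2)[of x] by (cases "\<bar>x\<bar> > K") (auto simp: indicator_def)
  ultimately show ?thesis using 1 by (simp only:)
qed

lemma integral_scale:
  fixes f :: "real \<Rightarrow> real"
  shows "\<delta> > 0 \<Longrightarrow> (\<integral>z. f (\<delta> * z) \<partial>lborel) = (\<integral>x. f x \<partial>lborel) / \<delta>"
  using lborel_integral_real_affine[of \<delta> f 0] by simp

definition bump_mass :: real where "bump_mass = (\<integral>x. (bump x)\<^sup>2 \<partial>lborel)"
definition bump_energy :: real where "bump_energy = (\<integral>x. (bump' x)\<^sup>2 \<partial>lborel)"

text \<open>The bump is bounded below by a positive constant on \<open>{-1/2..1/2}\<close>.\<close>

lemma bump_mass_pos: "bump_mass > 0"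
proof -
  have c: "continuous_on S (\<lambda>x. (bump x)\<^sup>2)" for S
    using smooth_on_continuous[OF bump_smooth] by (auto intro!: continuous_intros intro: continuous_on_subset)
  have "integrable lborel (\<lambda>x. indicator {-1..1} x *\<^sub>R (bump x)\<^sup>2)"
    by (rule borel_integrable_compact[OF compact_Icc c])
  moreover have "indicator {-1..1} x *\<^sub>R (bump x)\<^sup>2 = (bump x)\<^sup>2" for x
    using bump_eq_0[of x] by (cases "\<bar>x\<bar> \<ge> 1") (auto simp: indicator_def)
  ultimately have i: "integrable lborel (\<lambda>x. (bump x)\<^sup>2)" by (simp only:)
  have "0 < (\<integral>x. indicator {-1/2..1/2} x * (exp (-2 :: real))\<^sup>2 \<partial>(lborel :: real measure))" by simp
  also have "\<dots> \<le> bump_mass" unfolding bump_mass_def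
  proof (rule integral_mono[OF _ i])
    show "indicator {-1/2..1/2} x * (exp (-2))\<^sup>2 \<le> (bump x)\<^sup>2" for x :: real
      using power_mono[OF bump_ge[of x], of 2] by (auto simp: indicator_def abs_le_iff)
  qed (auto intro!: integrable_mult_left)
  finally show ?thesis .
qed

lemma cutoff_mass:
  assumes "\<epsilon> > 0" "\<delta> > 0"
  shows "integral_mu (-1) (\<lambda>q. (cutoff \<epsilon> \<delta> q)\<^sup>2) = bump_mass / \<epsilon> * (bump_mass / \<delta>)"
proof -
  have "integral_mu (-1) (\<lambda>q. (cutoff \<epsilon> \<delta> q)\<^sup>2) =
    (\<integral>r. (if r > 0 then r powr -1 * (bump (\<epsilon> * ln r))\<^sup>2 else 0) \<partial>lborel) * (\<integral>z. (bump (\<delta> * z))\<^sup>2 \<partial>lborel)"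
  proof (rule integral_mu_product)
    show "test_function (\<lambda>q. (cutoff \<epsilon> \<delta> q)\<^sup>2)"
      by (intro test_function_intros test_function_cutoff assms)
  qed (simp add: cutoff_def half_plane_iff power_mult_distrib)
  also have "(\<integral>z. (bump (\<delta> * z))\<^sup>2 \<partial>lborel) = bump_mass / \<delta>"
    unfolding bump_mass_def using integral_scale[OF assms(2), of "\<lambda>x. (bump x)\<^sup>2"] .
  also have "(\<integral>r. (if r > 0 then r powr -1 * (bump (\<epsilon> * ln r))\<^sup>2 else 0) \<partial>lborel)
    = (\<integral>r. (if r > 0 then (bump (\<epsilon> * ln r))\<^sup>2 / r else 0) \<partial>lborel)"
    by (intro Bochner_Integration.integral_cong) (auto simp: powr_minus divide_simps)
  also have "\<dots> = bump_mass / \<epsilon>"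
    unfolding bump_mass_def
    by (rule integral_log_substitution[of "\<lambda>x. (bump x)\<^sup>2" 1])
       (use assms bump_eq_0 smooth_on_continuous[OF bump_smooth] in \<open>auto intro!: continuous_intros\<close>)
  finally show ?thesis .
qed

lemma cutoff_radial_energy:
  assumes "\<epsilon> > 0" "\<delta> > 0"
  shows "integral_mu 1 (\<lambda>q. (D_r (cutoff \<epsilon> \<delta>) q)\<^sup>2) = \<epsilon>\<^sup>2 * (bump_energy / \<epsilon>) * (bump_mass / \<delta>)"
proof -
  have "integral_mu 1 (\<lambda>q. (D_r (cutoff \<epsilon> \<delta>) q)\<^sup>2) =
    (\<integral>r. (if r > 0 then r powr 1 * (\<epsilon> * bump' (\<epsilon> * ln r) / r)\<^sup>2 else 0) \<partial>lborel) * (\<integral>z. (bump (\<delta> * z))\<^sup>2 \<partial>lborel)"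
    by (rule integral_mu_product) (auto intro!: test_function_intros test_function_cutoff assms
       simp: ddir_cutoff power_mult_distrib power_divide)
  also have "(\<integral>z. (bump (\<delta> * z))\<^sup>2 \<partial>lborel) = bump_mass / \<delta>"
    unfolding bump_mass_def using integral_scale[OF assms(2), of "\<lambda>x. (bump x)\<^sup>2"] .
  also have "(\<integral>r. (if r > 0 then r powr 1 * (\<epsilon> * bump' (\<epsilon> * ln r) / r)\<^sup>2 else 0) \<partial>lborel)
    = (\<integral>r. \<epsilon>\<^sup>2 * (if r > 0 then (bump' (\<epsilon> * ln r))\<^sup>2 / r else 0) \<partial>lborel)"
    by (intro Bochner_Integration.integral_cong) (auto simp: power2_eq_square divide_simps)
  also have "\<dots> = \<epsilon>\<^sup>2 * (bump_energy / \<epsilon>)"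
    unfolding bump_energy_def integral_mult_right_zero
    by (subst integral_log_substitution[of "\<lambda>x. (bump' x)\<^sup>2" 1])
       (use assms bump'_eq_0 smooth_on_continuous[OF bump'_smooth] in \<open>auto intro!: continuous_intros\<close>)
  finally show ?thesis .
qed

text \<open>The constant depends on \<open>\<epsilon>\<close> in an uncontrolled way. This is harmless, because \<open>\<delta>\<close> tends to \<open>0\<close> first.\<close>

lemma cutoff_axial_energy:
  assumes "\<epsilon> > 0"
  obtains C where "\<And>\<delta>. \<delta> > 0 \<Longrightarrow> integral_mu 1 (\<lambda>q. (D_z (cutoff \<epsilon> \<delta>) q)\<^sup>2) = C * (\<delta>\<^sup>2 * (bump_energy / \<delta>))"
proof
  fix \<delta> :: real assume d: "\<delta> > 0"
  have "integral_mu 1 (\<lambda>q. (D_z (cutoff \<epsilon> \<delta>) q)\<^sup>2) =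
    (\<integral>r. (if r > 0 then r powr 1 * (bump (\<epsilon> * ln r))\<^sup>2 else 0) \<partial>lborel) * (\<integral>z. \<delta>\<^sup>2 * (bump' (\<delta> * z))\<^sup>2 \<partial>lborel)"
    by (rule integral_mu_product) (auto intro!: test_function_intros test_function_cutoff assms d
       simp: ddir_cutoff power_mult_distrib)
  also have "(\<integral>z. \<delta>\<^sup>2 * (bump' (\<delta> * z))\<^sup>2 \<partial>lborel) = \<delta>\<^sup>2 * (bump_energy / \<delta>)"
    unfolding bump_energy_def integral_mult_right_zero using integral_scale[OF d, of "\<lambda>x. (bump' x)\<^sup>2"] by simp
  finally show "integral_mu 1 (\<lambda>q. (D_z (cutoff \<epsilon> \<delta>) q)\<^sup>2) =
    (\<integral>r. (if r > 0 then r powr 1 * (bump (\<epsilon> * ln r))\<^sup>2 else 0) \<partial>lborel) * (\<delta>\<^sup>2 * (bump_energy / \<delta>))" .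
qed

section \<open>Self-adjointness\<close>

text \<open>The left integrands differ by a divergence with respect to \<open>\<mu>\<^sub>\<alpha>\<close>, except for the part of the first-order
term \<open>3 / r\<close> that the weight does not absorb.\<close>

lemma Delta5_Green:
  assumes \<phi>: "test_function \<phi>" and \<psi>: "test_function \<psi>"
  shows "integral_mu \<alpha> (\<lambda>q. Delta5 \<phi> q * \<psi> q) - integral_mu \<alpha> (\<lambda>q. \<phi> q * Delta5 \<psi> q)
    = (3 - \<alpha>) * integral_mu (\<alpha> - 1) (\<lambda>q. D_r \<phi> q * \<psi> q - \<phi> q * D_r \<psi> q)"
proof -
  let ?f = "\<lambda>q. D_r \<phi> q * \<psi> q - \<phi> q * D_r \<psi> q"
  let ?g = "\<lambda>q. D_z \<phi> q * \<psi> q - \<phi> q * D_z \<psi> q"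
  have tf: "test_function ?f" and tg: "test_function ?g"
    by (intro test_function_intros \<phi> \<psi>)+
  have D: "ddir v (\<lambda>q. ddir v \<phi> q * \<psi> q - \<phi> q * ddir v \<psi> q) q
    = ddir v (ddir v \<phi>) q * \<psi> q - \<phi> q * ddir v (ddir v \<psi>) q" for v q
  proof -
    note d = test_function_differentiable[OF \<phi>, THEN has_derivative_ddir]
      test_function_differentiable[OF \<psi>, THEN has_derivative_ddir]
      test_function_differentiable[OF test_function_ddir[OF \<phi>], THEN has_derivative_ddir]
      test_function_differentiable[OF test_function_ddir[OF \<psi>], THEN has_derivative_ddir]
    show ?thesis
      by (subst ddir_eqI) (rule has_derivative_diff has_derivative_mult d | simp)+
  qed
  have tD: "test_function (Delta5 u)" if "test_function u" for u
  proof -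
    have "test_function (\<lambda>q. D_r (D_r u) q + 3 * (D_r u q / fst q) + D_z (D_z u) q)"
      by (intro test_function_intros that)
    then show ?thesis by (simp add: Delta5_def[abs_def])
  qed
  have "integral_mu \<alpha> (\<lambda>q. Delta5 \<phi> q * \<psi> q) - integral_mu \<alpha> (\<lambda>q. \<phi> q * Delta5 \<psi> q)
    = integral_mu \<alpha> (\<lambda>q. Delta5 \<phi> q * \<psi> q - \<phi> q * Delta5 \<psi> q)"
    by (rule integral_mu_minus[symmetric]; intro test_function_intros tD \<phi> \<psi>)
  also have "\<dots> = integral_mu \<alpha> (\<lambda>q. (D_r ?f q + \<alpha> / fst q * ?f q + D_z ?g q) + (3 - \<alpha>) * (?f q / fst q))"
  proof (rule integral_mu_cong)
    fix q :: "real \<times> real" assume "q \<in> half_plane"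
    then have "fst q > 0" by (simp add: half_plane_iff)
    then show "Delta5 \<phi> q * \<psi> q - \<phi> q * Delta5 \<psi> q
      = (D_r ?f q + \<alpha> / fst q * ?f q + D_z ?g q) + (3 - \<alpha>) * (?f q / fst q)"
      unfolding D Delta5_def by (simp add: field_simps)
  qed
  also have "\<dots> = integral_mu \<alpha> (\<lambda>q. D_r ?f q + \<alpha> / fst q * ?f q + D_z ?g q)
      + integral_mu \<alpha> (\<lambda>q. (3 - \<alpha>) * (?f q / fst q))"
  proof (rule integral_mu_add)
    have "test_function (\<lambda>q. D_r ?f q + \<alpha> * (?f q / fst q) + D_z ?g q)"
      by (intro test_function_intros tf tg \<phi> \<psi>)
    then show "test_function (\<lambda>q. D_r ?f q + \<alpha> / fst q * ?f q + D_z ?g q)" by simp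
    show "test_function (\<lambda>q. (3 - \<alpha>) * (?f q / fst q))"
      by (intro test_function_intros \<phi> \<psi>)
  qed
  also have "integral_mu \<alpha> (\<lambda>q. D_r ?f q + \<alpha> / fst q * ?f q + D_z ?g q) = 0"
    by (rule integral_mu_divergence[OF tf tg])
  also have "integral_mu \<alpha> (\<lambda>q. (3 - \<alpha>) * (?f q / fst q)) = (3 - \<alpha>) * integral_mu \<alpha> (\<lambda>q. ?f q / fst q)"
    by (rule integral_mu_cmult)
  also have "integral_mu \<alpha> (\<lambda>q. ?f q / fst q) = integral_mu \<alpha> (\<lambda>q. fst q powr -1 * ?f q)"
    by (rule integral_mu_cong) (auto simp: half_plane_def powr_minus divide_simps)
  also have "\<dots> = integral_mu (\<alpha> - 1) ?f"
    using integral_mu_powr[of \<alpha> "-1" ?f] by simp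
  finally show ?thesis by simp
qed

text \<open>For the forward direction the pair \<open>r \<chi>\<close>, \<open>\<chi>\<close> is tested, because then the integrand on the right of
\<open>Delta5_Green\<close> is \<open>\<chi>\<^sup>2\<close>. The factor \<open>r powr (- \<alpha> / 2)\<close> in \<open>\<chi>\<close> reduces the integral of \<open>\<chi>\<^sup>2\<close> to the
mass of a cutoff, which is known to be positive.\<close>

lemma Delta5_self_adjoint_iff: "Delta5_self_adjoint \<alpha> \<longleftrightarrow> \<alpha> = 3"
proof
  assume "\<alpha> = 3"
  then show "Delta5_self_adjoint \<alpha>"
    using Delta5_Green[of _ _ \<alpha>] by (auto simp: Delta5_self_adjoint_def)
next
  assume sa: "Delta5_self_adjoint \<alpha>"
  let ?\<chi> = "\<lambda>q. fst q powr (- \<alpha> / 2) * cutoff 1 1 q"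
  have t: "test_function ?\<chi>" by (intro test_function_powr test_function_cutoff) auto
  have "D_r (\<lambda>q. fst q * ?\<chi> q) q * ?\<chi> q - fst q * ?\<chi> q * D_r ?\<chi> q = (?\<chi> q)\<^sup>2" for q
  proof -
    have "D_r (\<lambda>q. fst q * ?\<chi> q) q = fst q * D_r ?\<chi> q + D_r fst q * ?\<chi> q"
      by (intro ddir_mult test_function_differentiable[OF t] bounded_linear_imp_differentiable bounded_linear_fst)
    moreover have "D_r fst q = 1" by (simp add: ddir_linear bounded_linear_fst)
    moreover have "(r * d + 1 * x) * x - r * x * d = x\<^sup>2" for r d x :: real
      by (simp add: power2_eq_square algebra_simps)
    ultimately show ?thesis by (simp only:)
  qed
  then have "(3 - \<alpha>) * integral_mu (\<alpha> - 1) (\<lambda>q. (?\<chi> q)\<^sup>2) = 0"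
    using Delta5_Green[OF test_function_mult_fst[OF t] t, of \<alpha>] sa t test_function_mult_fst[OF t]
    by (simp only: Delta5_self_adjoint_def diff_self)
  moreover have "integral_mu (\<alpha> - 1) (\<lambda>q. (?\<chi> q)\<^sup>2)
    = integral_mu (\<alpha> - 1) (\<lambda>q. fst q powr - \<alpha> * (cutoff 1 1 q)\<^sup>2)"
    by (rule integral_mu_cong)
       (simp add: half_plane_iff power_mult_distrib power2_eq_square powr_add[symmetric])
  then have "integral_mu (\<alpha> - 1) (\<lambda>q. (?\<chi> q)\<^sup>2) = bump_mass * bump_mass"
    using integral_mu_powr[of "\<alpha> - 1" "- \<alpha>" "\<lambda>q. (cutoff 1 1 q)\<^sup>2"] cutoff_mass[of 1 1] by simp
  ultimately show "\<alpha> = 3" using bump_mass_pos by simp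
qed

section \<open>Sharp gaps\<close>

lemma integral_mu_nonneg:
  assumes "\<And>q. q \<in> half_plane \<Longrightarrow> f q \<ge> 0" shows "integral_mu \<alpha> f \<ge> 0"
  unfolding integral_mu_def set_lebesgue_integral_def
  by (rule Bochner_Integration.integral_nonneg) (auto simp: indicator_def assms)

lemma le_of_le_add_square:
  fixes X Y Z :: real
  assumes "\<And>x. x > 0 \<Longrightarrow> X \<le> Y + Z * x\<^sup>2"
  shows "X \<le> Y"
proof (rule tendsto_lowerbound)
  show "((\<lambda>x. Y + Z * x\<^sup>2) \<longlongrightarrow> Y) (at_right 0)"
    by (auto intro!: tendsto_eq_intros)
  show "\<forall>\<^sub>F x in at_right 0. X \<le> Y + Z * x\<^sup>2"
    using assms by (auto simp: eventually_at_filter)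
qed simp

text \<open>Division by the virtual ground state \<open>r powr (- (\<alpha> - 1) / 2)\<close> removes \<open>\<alpha>\<close> from the remainder in
\<open>Hardy_identity\<close>: it becomes the energy of the cutoff for the weight \<open>r\<close>.\<close>

lemma Hardy_trial:
  fixes \<alpha> \<epsilon> \<delta> :: real
  defines "h \<equiv> \<lambda>q. fst q powr (- (\<alpha> - 1) / 2) * cutoff \<epsilon> \<delta> q"
  assumes "\<epsilon> > 0" "\<delta> > 0"
  shows "test_function h"
    and "integral_mu (\<alpha> - 2) (\<lambda>q. (h q)\<^sup>2) = integral_mu (-1) (\<lambda>q. (cutoff \<epsilon> \<delta> q)\<^sup>2)"
    and "gradient_energy \<alpha> h = ((\<alpha> - 1) / 2)\<^sup>2 * integral_mu (-1) (\<lambda>q. (cutoff \<epsilon> \<delta> q)\<^sup>2)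
      + (integral_mu 1 (\<lambda>q. (D_r (cutoff \<epsilon> \<delta>) q)\<^sup>2) + integral_mu 1 (\<lambda>q. (D_z (cutoff \<epsilon> \<delta>) q)\<^sup>2))"
proof -
  note tc = test_function_cutoff[OF assms(2,3)]
  show th: "test_function h" unfolding h_def by (intro test_function_powr tc)
  let ?p = "\<lambda>q. fst q powr (- (\<alpha> - 1) / 2)"
  have pp: "?p q * ?p q = fst q powr (1 - \<alpha>)" if "q \<in> half_plane" for q
    unfolding powr_add[symmetric] by (rule arg_cong[where f = "\<lambda>x. fst q powr x"]) (simp add: field_simps)
  have "integral_mu (\<alpha> - 2) (\<lambda>q. (h q)\<^sup>2) = integral_mu (\<alpha> - 2) (\<lambda>q. fst q powr (1 - \<alpha>) * (cutoff \<epsilon> \<delta> q)\<^sup>2)"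
    by (rule integral_mu_cong) (simp add: h_def pp[symmetric] power2_eq_square)
  then show m: "integral_mu (\<alpha> - 2) (\<lambda>q. (h q)\<^sup>2) = integral_mu (-1) (\<lambda>q. (cutoff \<epsilon> \<delta> q)\<^sup>2)"
    by (simp add: integral_mu_powr)
  have D: "ddir v h q = ?p q * ddir v (cutoff \<epsilon> \<delta>) q - (\<alpha> - 1) / 2 * h q / fst q * fst v"
    if "q \<in> half_plane" for q v
  proof -
    have "fst q powr (- (\<alpha> - 1) / 2 - 1) = ?p q / fst q"
      using that by (simp only: powr_diff half_plane_iff powr_one)
    then have "ddir v h q = ?p q * ddir v (cutoff \<epsilon> \<delta>) q
        + - (\<alpha> - 1) / 2 * (?p q / fst q) * fst v * cutoff \<epsilon> \<delta> q"
      unfolding h_def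
      by (simp only: ddir_mult differentiable_powr_fst[OF that] test_function_differentiable[OF tc] ddir_powr_fst[OF that])
    moreover have "- (\<alpha> - 1) / 2 * (?p q / fst q) * fst v * cutoff \<epsilon> \<delta> q
        = - ((\<alpha> - 1) / 2 * (?p q * cutoff \<epsilon> \<delta> q) / fst q * fst v)"
      by (simp only: minus_divide_left[symmetric] mult_minus_left) (simp only: times_divide_eq_right times_divide_eq_left mult_ac)
    ultimately show ?thesis by (simp only: h_def diff_conv_add_uminus)
  qed
  have "integral_mu \<alpha> (\<lambda>q. (D_r h q + (\<alpha> - 1) / 2 * h q / fst q)\<^sup>2 + (D_z h q)\<^sup>2)
    = integral_mu \<alpha> (\<lambda>q. fst q powr (1 - \<alpha>) * ((D_r (cutoff \<epsilon> \<delta>) q)\<^sup>2 + (D_z (cutoff \<epsilon> \<delta>) q)\<^sup>2))"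
    by (rule integral_mu_cong) (simp add: D pp[symmetric] power2_eq_square algebra_simps)
  also have "\<dots> = integral_mu 1 (\<lambda>q. (D_r (cutoff \<epsilon> \<delta>) q)\<^sup>2 + (D_z (cutoff \<epsilon> \<delta>) q)\<^sup>2)"
    by (simp add: integral_mu_powr)
  also have "\<dots> = integral_mu 1 (\<lambda>q. (D_r (cutoff \<epsilon> \<delta>) q)\<^sup>2) + integral_mu 1 (\<lambda>q. (D_z (cutoff \<epsilon> \<delta>) q)\<^sup>2)"
    by (intro integral_mu_add test_function_intros tc)
  finally show "gradient_energy \<alpha> h = ((\<alpha> - 1) / 2)\<^sup>2 * integral_mu (-1) (\<lambda>q. (cutoff \<epsilon> \<delta> q)\<^sup>2)
      + (integral_mu 1 (\<lambda>q. (D_r (cutoff \<epsilon> \<delta>) q)\<^sup>2) + integral_mu 1 (\<lambda>q. (D_z (cutoff \<epsilon> \<delta>) q)\<^sup>2))"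
    using Hardy_identity[OF th, of \<alpha>] m by simp
qed

text \<open>That the constant is admissible is Hardy's inequality. Conversely, an admissible \<open>c\<close> tested on \<open>Hardy_trial\<close>
gives, after multiplication by \<open>\<epsilon> * \<delta>\<close>, an inequality between a constant multiple of \<open>bump_mass\<^sup>2\<close> and
terms of order \<open>\<epsilon>\<^sup>2\<close> and, for fixed \<open>\<epsilon>\<close>, \<open>\<delta>\<^sup>2\<close>.\<close>

lemma sharp_gap_eq:
  assumes "\<alpha> > 1" "b \<le> 0"
  shows "sharp_gap \<alpha> (\<lambda>h. a * gradient_energy \<alpha> h + b * integral_mu (\<alpha> - 2) (\<lambda>q. (h q)\<^sup>2))
    = a + 4 * b / (\<alpha> - 1)\<^sup>2"
  unfolding sharp_gap_def
proof (rule cSup_eq_maximum)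
  let ?c = "a + 4 * b / (\<alpha> - 1)\<^sup>2" and ?k = "((\<alpha> - 1) / 2)\<^sup>2"
  let ?H = "\<lambda>h. integral_mu (\<alpha> - 2) (\<lambda>q. (h q)\<^sup>2)"
  have k: "?k > 0" using assms(1) by simp
  have c: "?c = a + b / ?k" using assms(1) by (simp add: power2_eq_square field_simps)
  show "?c \<in> {c. \<forall>h. test_function h \<longrightarrow> c * gradient_energy \<alpha> h \<le> a * gradient_energy \<alpha> h + b * ?H h}"
  proof safe
    fix h assume h: "test_function h"
    have "?k * ?H h \<le> gradient_energy \<alpha> h"
      unfolding Hardy_identity[OF h, of \<alpha>] by (simp add: integral_mu_nonneg)
    then have "b / ?k * gradient_energy \<alpha> h \<le> b / ?k * (?k * ?H h)"
      using k assms(2) by (intro mult_left_mono_neg) (auto simp: divide_nonpos_pos)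
    then have "b / ?k * gradient_energy \<alpha> h \<le> b * ?H h" using k by simp
    then show "?c * gradient_energy \<alpha> h \<le> a * gradient_energy \<alpha> h + b * ?H h"
      unfolding c by (simp add: distrib_right)
  qed
  fix c assume "c \<in> {c. \<forall>h. test_function h \<longrightarrow> c * gradient_energy \<alpha> h \<le> a * gradient_energy \<alpha> h + b * ?H h}"
  then have cE: "c * gradient_energy \<alpha> h \<le> a * gradient_energy \<alpha> h + b * ?H h" if "test_function h" for h
    using that by blast
  \<comment> \<open>Below, \<open>k * H + R\<close> is the energy of the trial function, split as in the Hardy identity.\<close>
  have split: "((c - a) * k - b) * H \<le> (a - c) * R" if "c * (k * H + R) \<le> a * (k * H + R) + b * H"
    for k H R
    using that by (simp add: algebra_simps)
  let ?A = bump_mass and ?B = bump_energy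
  let ?X = "((c - a) * ?k - b) * (?A * ?A)"
  have "?X \<le> 0 + (a - c) * ?A * ?B * \<epsilon>\<^sup>2" if e: "\<epsilon> > 0" for \<epsilon>
  proof -
    obtain C where C: "\<And>\<delta>. \<delta> > 0 \<Longrightarrow> integral_mu 1 (\<lambda>q. (D_z (cutoff \<epsilon> \<delta>) q)\<^sup>2) = C * (\<delta>\<^sup>2 * (?B / \<delta>))"
      using cutoff_axial_energy[OF e] by blast
    have "?X \<le> (a - c) * ?A * ?B * \<epsilon>\<^sup>2 + (a - c) * C * \<epsilon> * ?B * \<delta>\<^sup>2" if d: "\<delta> > 0" for \<delta>
    proof -
      let ?h = "\<lambda>q. fst q powr (- (\<alpha> - 1) / 2) * cutoff \<epsilon> \<delta> q"
      note T = Hardy_trial[OF e d, of \<alpha>, unfolded cutoff_mass[OF e d] cutoff_radial_energy[OF e d] C[OF d]]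
      from cE[OF T(1), unfolded T(2,3)]
      have "((c - a) * ?k - b) * (?A / \<epsilon> * (?A / \<delta>))
         \<le> (a - c) * (\<epsilon>\<^sup>2 * (?B / \<epsilon>) * (?A / \<delta>) + C * (\<delta>\<^sup>2 * (?B / \<delta>)))"
        by (rule split)
      then have "((c - a) * ?k - b) * (?A / \<epsilon> * (?A / \<delta>)) * (\<epsilon> * \<delta>)
         \<le> (a - c) * (\<epsilon>\<^sup>2 * (?B / \<epsilon>) * (?A / \<delta>) + C * (\<delta>\<^sup>2 * (?B / \<delta>))) * (\<epsilon> * \<delta>)"
        by (rule mult_right_mono) (use e d in simp)
      moreover have "((c - a) * ?k - b) * (?A / \<epsilon> * (?A / \<delta>)) * (\<epsilon> * \<delta>) = ?X"
        using e d by simp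
      moreover have "(a - c) * (\<epsilon>\<^sup>2 * (?B / \<epsilon>) * (?A / \<delta>) + C * (\<delta>\<^sup>2 * (?B / \<delta>))) * (\<epsilon> * \<delta>)
        = (a - c) * ?A * ?B * \<epsilon>\<^sup>2 + (a - c) * C * \<epsilon> * ?B * \<delta>\<^sup>2"
        using e d by (simp add: field_simps power2_eq_square)
      ultimately show ?thesis by simp
    qed
    then have "?X \<le> (a - c) * ?A * ?B * \<epsilon>\<^sup>2" by (rule le_of_le_add_square)
    then show ?thesis by simp
  qed
  then have "?X \<le> 0" by (rule le_of_le_add_square)
  then have "(c - a) * ?k \<le> b" using bump_mass_pos by (simp add: mult_le_0_iff)
  then have "c - a \<le> b / ?k" using k by (simp add: pos_le_divide_eq)
  then show "c \<le> ?c" unfolding c by simp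
qed

lemma F_gap_eq:
  assumes "\<alpha> \<ge> 3" "p > 0"
  shows "F_gap \<alpha> p = 4 * (2 * p + 1 - \<alpha>) / (p\<^sup>2 * (\<alpha> - 1))"
proof -
  have "(3 - \<alpha>) * (\<alpha> - 1) / p \<le> 0"
    using assms by (auto intro!: divide_nonpos_pos mult_nonpos_nonneg)
  then have "F_gap \<alpha> p = 4 * (p - 1) / p\<^sup>2 + 4 * ((3 - \<alpha>) * (\<alpha> - 1) / p) / (\<alpha> - 1)\<^sup>2"
    unfolding F_gap_def F_diffusion_form_def[abs_def] using assms by (intro sharp_gap_eq) auto
  also have "\<dots> = 4 * (2 * p + 1 - \<alpha>) / (p\<^sup>2 * (\<alpha> - 1))"
    using assms by (simp add: divide_simps power2_eq_square) (simp add: algebra_simps)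
  finally show ?thesis .
qed

lemma G_gap_eq:
  assumes "\<alpha> \<ge> 3"
  shows "G_gap \<alpha> = (5 - \<alpha>) / (\<alpha> - 1)"
proof -
  \<comment> \<open>The form for \<open>G\<close> is the one for \<open>F\<close> with \<open>p = 2\<close>, so that a single computation gives both gaps.\<close>
  have "G_diffusion_form \<alpha> = F_diffusion_form \<alpha> 2"
    by (simp add: fun_eq_iff G_diffusion_form_def F_diffusion_form_def)
  then have "G_gap \<alpha> = F_gap \<alpha> 2" by (simp add: G_gap_def F_gap_def)
  also have "\<dots> = 4 * (2 * 2 + 1 - \<alpha>) / (2\<^sup>2 * (\<alpha> - 1))" by (rule F_gap_eq) (use assms in auto)
  also have "\<dots> = (5 - \<alpha>) / (\<alpha> - 1)" using assms by (simp add: divide_simps) (simp add: algebra_simps)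
  finally show ?thesis .
qed

section \<open>Ratios and thresholds\<close>

lemma form_bound_threshold_eq:
  assumes "s > 0"
  shows "form_bound_threshold \<nu> s g = \<nu> * g / s"
proof -
  have "{\<Lambda>. s * \<Lambda> < \<nu> * g} = {..<\<nu> * g / s}"
    using assms by (auto simp: pos_less_divide_eq mult.commute)
  then show ?thesis by (simp add: form_bound_threshold_def)
qed

lemma is_arg_min_strict_mono:
  fixes f :: "real \<Rightarrow> real"
  assumes "\<And>x y. a \<le> x \<Longrightarrow> x < y \<Longrightarrow> y < b \<Longrightarrow> f x < f y" "a < b"
  shows "is_arg_min f (\<lambda>x. x \<in> {a..<b}) y \<longleftrightarrow> y = a"
proof
  assume *: "is_arg_min f (\<lambda>x. x \<in> {a..<b}) y"
  then have "y \<in> {a..<b}" "\<not> f a < f y" using assms(2) by (auto simp: is_arg_min_def)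
  then show "y = a" using assms(1)[of a y] by fastforce
next
  assume "y = a"
  moreover have "\<not> f x < f a" if "x \<in> {a..<b}" for x
    using assms(1)[of a x] that by (cases "x = a") auto
  ultimately show "is_arg_min f (\<lambda>x. x \<in> {a..<b}) y" using assms(2) by (auto simp: is_arg_min_def)
qed

lemma is_arg_max_strict_antimono:
  fixes f :: "real \<Rightarrow> real"
  assumes "\<And>x y. a \<le> x \<Longrightarrow> x < y \<Longrightarrow> y < b \<Longrightarrow> f x > f y" "a < b"
  shows "is_arg_max f (\<lambda>x. x \<in> {a..<b}) y \<longleftrightarrow> y = a"
  using is_arg_min_strict_mono[of a b "\<lambda>x. - f x" y] assms by (simp add: is_arg_min_def is_arg_max_def)

lemma G_ratios:
  assumes "\<alpha> \<in> {3..<5}"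
  shows "G_strain \<alpha> / G_gap \<alpha> = (\<alpha> - 1)\<^sup>2 / (2 * (5 - \<alpha>))"
    and "form_bound_threshold \<nu> (G_strain \<alpha>) (G_gap \<alpha>) = 2 * \<nu> * (5 - \<alpha>) / (\<alpha> - 1)\<^sup>2"
proof -
  have gap: "G_gap \<alpha> = (5 - \<alpha>) / (\<alpha> - 1)" using G_gap_eq assms by simp
  show "G_strain \<alpha> / G_gap \<alpha> = (\<alpha> - 1)\<^sup>2 / (2 * (5 - \<alpha>))"
    unfolding gap G_strain_def by (simp add: power2_eq_square)
  show "form_bound_threshold \<nu> (G_strain \<alpha>) (G_gap \<alpha>) = 2 * \<nu> * (5 - \<alpha>) / (\<alpha> - 1)\<^sup>2"
    using assms form_bound_threshold_eq[of "G_strain \<alpha>" \<nu> "G_gap \<alpha>"]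
    unfolding gap G_strain_def by (simp add: power2_eq_square)
qed

lemma F_ratios:
  assumes "p > 0" "\<alpha> \<in> {3..<2 * p + 1}"
  shows "F_strain \<alpha> p / F_gap \<alpha> p = p * (\<alpha> - 1) / 4"
    and "form_bound_threshold \<nu> (F_strain \<alpha> p) (F_gap \<alpha> p) = 4 * \<nu> / (p * (\<alpha> - 1))"
proof -
  have gap: "F_gap \<alpha> p = 4 * (2 * p + 1 - \<alpha>) / (p\<^sup>2 * (\<alpha> - 1))" using F_gap_eq assms by simp
  have cancel: "s / p / (4 * s / (p\<^sup>2 * (\<alpha> - 1))) = p * (\<alpha> - 1) / 4"
    "\<nu> * (4 * s / (p\<^sup>2 * (\<alpha> - 1))) / (s / p) = 4 * \<nu> / (p * (\<alpha> - 1))" if "s > 0" for s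
    using that assms by (simp_all add: power2_eq_square)
  have s: "2 * p + 1 - \<alpha> > 0" using assms by simp
  show "F_strain \<alpha> p / F_gap \<alpha> p = p * (\<alpha> - 1) / 4"
    unfolding gap F_strain_def by (rule cancel(1)[OF s])
  have "F_strain \<alpha> p > 0" using assms by (simp add: F_strain_def)
  from form_bound_threshold_eq[OF this]
  show "form_bound_threshold \<nu> (F_strain \<alpha> p) (F_gap \<alpha> p) = 4 * \<nu> / (p * (\<alpha> - 1))"
    using cancel(2)[OF s] by (simp only: gap F_strain_def)
qed

lemma G_ratio_minimal:
  "is_arg_min (\<lambda>\<alpha>. G_strain \<alpha> / G_gap \<alpha>) (\<lambda>\<alpha>. \<alpha> \<in> {3..<5}) \<beta> \<longleftrightarrow> \<beta> = 3"
proof (rule is_arg_min_strict_mono)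
  fix x y :: real assume "3 \<le> x" "x < y" "y < 5"
  moreover then have "(x - 1)\<^sup>2 < (y - 1)\<^sup>2" by (intro power_strict_mono) auto
  ultimately show "G_strain x / G_gap x < G_strain y / G_gap y"
    by (simp add: G_ratios(1) frac_less)
qed simp

lemma G_threshold_maximal:
  assumes "\<nu> > 0"
  shows "is_arg_max (\<lambda>\<alpha>. form_bound_threshold \<nu> (G_strain \<alpha>) (G_gap \<alpha>)) (\<lambda>\<alpha>. \<alpha> \<in> {3..<5}) \<beta> \<longleftrightarrow> \<beta> = 3"
proof (rule is_arg_max_strict_antimono)
  fix x y :: real assume xy: "3 \<le> x" "x < y" "y < 5"
  moreover then have "(x - 1)\<^sup>2 < (y - 1)\<^sup>2" by (intro power_strict_mono) auto
  ultimately have "2 * \<nu> * (5 - y) / (y - 1)\<^sup>2 < 2 * \<nu> * (5 - x) / (x - 1)\<^sup>2"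
    using assms by (intro frac_less) auto
  then show "form_bound_threshold \<nu> (G_strain x) (G_gap x) > form_bound_threshold \<nu> (G_strain y) (G_gap y)"
    using xy by (simp add: G_ratios(2))
qed simp

lemma F_ratio_minimal:
  assumes "p > 1"
  shows "is_arg_min (\<lambda>\<alpha>. F_strain \<alpha> p / F_gap \<alpha> p) (\<lambda>\<alpha>. \<alpha> \<in> {3..<2 * p + 1}) \<beta> \<longleftrightarrow> \<beta> = 3"
  by (rule is_arg_min_strict_mono) (use assms in \<open>simp_all add: F_ratios(1)\<close>)

lemma F_threshold_maximal:
  assumes "\<nu> > 0" "p > 1"
  shows "is_arg_max (\<lambda>\<alpha>. form_bound_threshold \<nu> (F_strain \<alpha> p) (F_gap \<alpha> p))
    (\<lambda>\<alpha>. \<alpha> \<in> {3..<2 * p + 1}) \<beta> \<longleftrightarrow> \<beta> = 3"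
proof (rule is_arg_max_strict_antimono)
  fix x y :: real assume xy: "3 \<le> x" "x < y" "y < 2 * p + 1"
  then have "4 * \<nu> / (p * (y - 1)) < 4 * \<nu> / (p * (x - 1))"
    using assms by (intro divide_strict_left_mono) auto
  then show "form_bound_threshold \<nu> (F_strain x p) (F_gap x p) > form_bound_threshold \<nu> (F_strain y p) (F_gap y p)"
    using xy assms by (simp add: F_ratios(2))
qed (use assms in simp)

section \<open>Rotations and cylindrical coordinates\<close>

definition rot :: "real \<Rightarrow> real^3 \<Rightarrow> real^3" where
  "rot \<theta> x = vector [cos \<theta> * x$1 - sin \<theta> * x$2, sin \<theta> * x$1 + cos \<theta> * x$2, x$3]"

lemma vec3_eq_iff: "x = (y :: real^3) \<longleftrightarrow> x$1 = y$1 \<and> x$2 = y$2 \<and> x$3 = y$3"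
  by (simp add: vec_eq_iff forall_3)

lemma inner_vec3: "x \<bullet> (y :: real^3) = x$1 * y$1 + x$2 * y$2 + x$3 * y$3"
  by (simp add: inner_vec_def sum_3)

lemma axis_nth_3: "axis i (1::real) $ j = (if i = j then 1 else 0)"
  by (simp add: axis_def)

lemma bounded_linear_rot: "bounded_linear (rot \<theta>)"
proof -
  have "linear (rot \<theta>)"
    by (rule linearI) (simp_all add: rot_def vec3_eq_iff algebra_simps)
  then show ?thesis by (rule linear_conv_bounded_linear[THEN iffD1])
qed

lemmas linear_rot = bounded_linear.linear[OF bounded_linear_rot]

lemma inner_rot: "rot \<theta> x \<bullet> rot \<theta> y = x \<bullet> y"
proof -
  have "(c * a - s * b) * (c * a' - s * b') + (s * a + c * b) * (s * a' + c * b') = a * a' + b * b'"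
    if "s\<^sup>2 + c\<^sup>2 = 1" for a b a' b' c s :: real
    using that by algebra
  from this[OF sin_cos_squared_add] show ?thesis by (simp add: rot_def inner_vec3)
qed

lemma cyl_eq: "cyl r \<theta> z = r *\<^sub>R e_r \<theta> + z *\<^sub>R e_z"
  by (simp add: cyl_def e_r_def e_z_def vec3_eq_iff)

lemma rot_cyl: "rot \<theta> (cyl r \<phi> z) = cyl r (\<phi> + \<theta>) z"
  and rot_e_r: "rot \<theta> (e_r \<phi>) = e_r (\<phi> + \<theta>)"
  and rot_e_theta: "rot \<theta> (e_theta \<phi>) = e_theta (\<phi> + \<theta>)"
  and rot_e_z: "rot \<theta> e_z = e_z"
  by (simp_all add: rot_def cyl_def e_r_def e_theta_def e_z_def vec3_eq_iff cos_add sin_add algebra_simps)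

lemma cyl_exists:
  obtains r \<theta> where "r \<ge> 0" "x = cyl r \<theta> (x$3)"
proof -
  let ?w = "Complex (x$1) (x$2)"
  have "x$1 = norm ?w * cos (Arg ?w)" "x$2 = norm ?w * sin (Arg ?w)"
    using arg_cong[OF rcis_cmod_Arg[of ?w], of Re] arg_cong[OF rcis_cmod_Arg[of ?w], of Im]
    by (simp_all only: Re_rcis Im_rcis complex.sel)
  then have "x = cyl (norm ?w) (Arg ?w) (x$3)" by (simp only: cyl_def vec3_eq_iff vector_3)
  then show ?thesis using that[OF norm_ge_zero] by blast
qed

lemma has_vector_derivative_cyl:
  "((\<lambda>\<theta>. cyl r \<theta> z) has_vector_derivative r *\<^sub>R e_theta \<theta>) (at \<theta>)"
proof -
  have "(\<lambda>\<theta>. cyl r \<theta> z) = (\<lambda>\<theta>. (r * cos \<theta>) *\<^sub>R axis 1 1 + (r * sin \<theta>) *\<^sub>R axis 2 1 + z *\<^sub>R axis 3 1)"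
    by (simp add: fun_eq_iff cyl_def vec3_eq_iff axis_nth_3)
  moreover have "r *\<^sub>R e_theta \<theta> = (r * - sin \<theta>) *\<^sub>R axis 1 1 + (r * cos \<theta>) *\<^sub>R axis 2 1 + 0"
    by (simp add: e_theta_def vec3_eq_iff axis_nth_3)
  moreover have "((\<lambda>\<theta>. (r * cos \<theta>) *\<^sub>R axis 1 1 + (r * sin \<theta>) *\<^sub>R axis 2 1 + z *\<^sub>R axis 3 (1::real)) has_vector_derivative
      (r * - sin \<theta>) *\<^sub>R axis 1 1 + (r * cos \<theta>) *\<^sub>R axis 2 1 + (0 :: real^3)) (at \<theta>)"
    by (auto intro!: derivative_eq_intros simp: has_vector_derivative_def scaleR_left_distrib algebra_simps)
  ultimately show ?thesis by (simp only:)
qed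

lemma has_derivative_along_circle:
  fixes f :: "real^3 \<Rightarrow> real"
  assumes "\<And>x. f differentiable (at x)"
  shows "((\<lambda>\<theta>. f (cyl r \<theta> z)) has_real_derivative r * ddir (e_theta \<theta>) f (cyl r \<theta> z)) (at \<theta>)"
proof -
  have "((\<lambda>\<theta>. f (cyl r \<theta> z)) has_derivative (\<lambda>h. ddir (h *\<^sub>R (r *\<^sub>R e_theta \<theta>)) f (cyl r \<theta> z))) (at \<theta>)"
    by (rule has_derivative_compose[where f = "\<lambda>\<theta>. cyl r \<theta> z", OF _ has_derivative_ddir[OF assms]])
       (use has_vector_derivative_cyl in \<open>simp add: has_vector_derivative_def\<close>)
  moreover have "(\<lambda>h. ddir (h *\<^sub>R (r *\<^sub>R e_theta \<theta>)) f (cyl r \<theta> z)) = (\<lambda>h. r * ddir (e_theta \<theta>) f (cyl r \<theta> z) * h)"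
    by (rule ext) (simp only: linear_cmul[OF linear_ddir[OF assms]] real_scaleR_def mult_ac)
  ultimately show ?thesis by (simp add: has_field_derivative_def)
qed

lemma ddir_e_theta:
  fixes f :: "real^3 \<Rightarrow> real"
  assumes "f differentiable (at x)"
  shows "ddir (e_theta \<theta>) f x = - sin \<theta> * partial 1 f x + cos \<theta> * partial 2 f x"
proof -
  have "e_theta \<theta> = - sin \<theta> *\<^sub>R axis 1 1 + cos \<theta> *\<^sub>R axis 2 1"
    by (simp add: e_theta_def vec3_eq_iff axis_nth_3)
  then show ?thesis
    by (simp only: linear_add[OF linear_ddir[OF assms]] linear_cmul[OF linear_ddir[OF assms]] partial_def real_scaleR_def)
qed

text \<open>Off the axis this restates axisymmetry. The points of the axis, where the cylindrical frame says nothing,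
are reached by continuity.\<close>

lemma axisymmetric_equivariant:
  assumes "axisymmetric T u" "t \<in> T" "continuous_on UNIV (u t)"
  shows "u t (rot \<theta> x) = rot \<theta> (u t x)"
proof -
  have off: "u t (rot \<theta> (cyl r \<phi> z)) = rot \<theta> (u t (cyl r \<phi> z))" if "r > 0" for r \<phi> z
    using assms(1,2) that
    by (simp add: axisymmetric_def rot_cyl linear_add[OF linear_rot] linear_cmul[OF linear_rot] rot_e_r rot_e_theta rot_e_z)
  obtain r \<phi> where x: "r \<ge> 0" "x = cyl r \<phi> (x$3)" by (rule cyl_exists)
  \<comment> \<open>This vanishes for \<open>s > 0\<close>, hence also at \<open>s = r\<close> in the limit from the right.\<close>
  let ?g = "\<lambda>s. u t (rot \<theta> (cyl s \<phi> (x$3))) - rot \<theta> (u t (cyl s \<phi> (x$3)))"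
  have "continuous_on UNIV (\<lambda>s. cyl s \<phi> (x$3))"
    unfolding cyl_eq by (intro continuous_intros)
  then have "continuous_on UNIV ?g"
    by (intro continuous_intros continuous_on_compose2[OF assms(3)] continuous_on_compose2[OF linear_continuous_on[OF bounded_linear_rot]]) auto
  then have "(?g \<longlongrightarrow> ?g r) (at_right r)"
    by (auto simp: continuous_on_def intro: tendsto_within_subset)
  moreover have "(?g \<longlongrightarrow> 0) (at_right r)"
    by (rule tendsto_eventually) (use off x(1) in \<open>auto simp: eventually_at_filter\<close>)
  ultimately have "?g r = 0" using tendsto_unique trivial_limit_at_right_real by blast
  then show ?thesis using x(2) by simp
qed

lemma partial_rot:
  assumes "\<And>x. f differentiable (at x)"
  shows "partial 1 (\<lambda>x. f (rot \<theta> x)) x = cos \<theta> *\<^sub>R partial 1 f (rot \<theta> x) + sin \<theta> *\<^sub>R partial 2 f (rot \<theta> x)"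
    and "partial 2 (\<lambda>x. f (rot \<theta> x)) x = - sin \<theta> *\<^sub>R partial 1 f (rot \<theta> x) + cos \<theta> *\<^sub>R partial 2 f (rot \<theta> x)"
    and "partial 3 (\<lambda>x. f (rot \<theta> x)) x = partial 3 f (rot \<theta> x)"
proof -
  have c: "ddir v (\<lambda>x. f (rot \<theta> x)) x = ddir (rot \<theta> v) f (rot \<theta> x)" for v
    by (subst ddir_compose) (use assms in \<open>auto simp: ddir_linear bounded_linear_rot bounded_linear_imp_differentiable\<close>)
  have e: "rot \<theta> (axis 1 1) = cos \<theta> *\<^sub>R axis 1 1 + sin \<theta> *\<^sub>R axis 2 1"
    "rot \<theta> (axis 2 1) = - sin \<theta> *\<^sub>R axis 1 1 + cos \<theta> *\<^sub>R axis 2 1"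
    "rot \<theta> (axis 3 1) = axis 3 1"
    by (simp_all add: rot_def vec3_eq_iff axis_nth_3)
  note l = linear_add[OF linear_ddir[OF assms]] linear_cmul[OF linear_ddir[OF assms]]
  show "partial 1 (\<lambda>x. f (rot \<theta> x)) x = cos \<theta> *\<^sub>R partial 1 f (rot \<theta> x) + sin \<theta> *\<^sub>R partial 2 f (rot \<theta> x)"
    "partial 2 (\<lambda>x. f (rot \<theta> x)) x = - sin \<theta> *\<^sub>R partial 1 f (rot \<theta> x) + cos \<theta> *\<^sub>R partial 2 f (rot \<theta> x)"
    "partial 3 (\<lambda>x. f (rot \<theta> x)) x = partial 3 f (rot \<theta> x)"
    by (simp_all only: partial_def c e l)
qed

text \<open>In the sum of the first two second derivatives the mixed terms cancel in pairs.\<close>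

lemma laplacian_rot:
  fixes f :: "real^3 \<Rightarrow> 'b::real_normed_vector"
  assumes "smooth_on UNIV f"
  shows "(\<Sum>i\<in>UNIV. partial i (partial i (\<lambda>x. f (rot \<theta> x))) x) = (\<Sum>i\<in>UNIV. partial i (partial i f) (rot \<theta> x))"
proof -
  have d: "f differentiable (at x)" "partial i f differentiable (at x)" for x i
    using smooth_on_differentiable[OF assms] smooth_on_differentiable[OF smooth_on_ddir[OF assms]]
    by (auto simp: partial_def)
  have dR: "(\<lambda>x. partial i f (rot \<theta> x)) differentiable (at x)" for x i
    using differentiable_chain_at[of "rot \<theta>" x "partial i f"] d
    by (simp add: o_def bounded_linear_imp_differentiable bounded_linear_rot)
  have lin: "partial j (\<lambda>x. a *\<^sub>R partial 1 f (rot \<theta> x) + b *\<^sub>R partial 2 f (rot \<theta> x)) x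
    = a *\<^sub>R partial j (\<lambda>x. partial 1 f (rot \<theta> x)) x + b *\<^sub>R partial j (\<lambda>x. partial 2 f (rot \<theta> x)) x" for a b j x
    unfolding partial_def[of j]
    by (rule ddir_eqI) (intro has_derivative_add has_derivative_scaleR_right has_derivative_ddir dR)
  have "(sin \<theta>)\<^sup>2 + (cos \<theta>)\<^sup>2 = 1" by simp
  then have *: "(cos \<theta> * cos \<theta>) *\<^sub>R v + (sin \<theta> * sin \<theta>) *\<^sub>R v = v" for v :: 'b
    by (simp add: scaleR_left_distrib[symmetric] power2_eq_square add.commute)
  have "partial 1 (partial 1 (\<lambda>x. f (rot \<theta> x))) x + partial 2 (partial 2 (\<lambda>x. f (rot \<theta> x))) x
    = ((cos \<theta> * cos \<theta>) *\<^sub>R partial 1 (partial 1 f) (rot \<theta> x) + (sin \<theta> * sin \<theta>) *\<^sub>R partial 1 (partial 1 f) (rot \<theta> x))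
    + ((cos \<theta> * cos \<theta>) *\<^sub>R partial 2 (partial 2 f) (rot \<theta> x) + (sin \<theta> * sin \<theta>) *\<^sub>R partial 2 (partial 2 f) (rot \<theta> x))"
    unfolding partial_rot(1,2)[OF d(1), abs_def] lin partial_rot(1,2)[OF d(2)]
    by (simp add: algebra_simps)
  then show ?thesis unfolding * sum_3
    by (simp add: partial_rot(3)[OF d(1), abs_def] partial_rot(3)[OF d(2)])
qed

lemma ddir_meridional:
  fixes f :: "real^3 \<Rightarrow> 'b::real_normed_vector"
  assumes "f differentiable (at (cyl (fst q) 0 (snd q)))"
  shows "(\<lambda>q. f (cyl (fst q) 0 (snd q))) differentiable (at q)"
    and "ddir (1, 0) (\<lambda>q. f (cyl (fst q) 0 (snd q))) q = partial 1 f (cyl (fst q) 0 (snd q))"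
    and "ddir (0, 1) (\<lambda>q. f (cyl (fst q) 0 (snd q))) q = partial 3 f (cyl (fst q) 0 (snd q))"
proof -
  let ?S = "\<lambda>q. cyl (fst q) 0 (snd q)"
  have S: "?S = (\<lambda>q. fst q *\<^sub>R axis 1 1 + snd q *\<^sub>R axis 3 1)"
    by (simp add: fun_eq_iff cyl_def vec3_eq_iff axis_nth_3)
  have "(?S has_derivative (\<lambda>v. fst v *\<^sub>R axis 1 1 + snd v *\<^sub>R axis 3 1)) (at q)"
    unfolding S by (auto intro!: derivative_eq_intros)
  from has_derivative_compose[OF this has_derivative_ddir[OF assms]]
  have D: "((\<lambda>q. f (?S q)) has_derivative (\<lambda>v. ddir (fst v *\<^sub>R axis 1 1 + snd v *\<^sub>R axis 3 1) f (?S q))) (at q)" .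
  then show "(\<lambda>q. f (?S q)) differentiable (at q)" by (auto simp: differentiable_def)
  show "ddir (1, 0) (\<lambda>q. f (?S q)) q = partial 1 f (?S q)" "ddir (0, 1) (\<lambda>q. f (?S q)) q = partial 3 f (?S q)"
    by (simp_all add: ddir_eqI[OF D] partial_def)
qed

section \<open>The azimuthal momentum balance\<close>

lemma C_k_on_slice:
  assumes "open T" "t \<in> T" "C_k_on k (T \<times> UNIV) f"
  shows "C_k_on k UNIV (\<lambda>x. f (t, x))"
  using assms(3)
proof (induction k arbitrary: f)
  case 0
  then show ?case using assms(2) by (auto intro!: continuous_on_compose2[of "T \<times> UNIV" f] continuous_intros)
next
  case (Suc k)
  have d: "f differentiable (at (t, x))" for x using Suc.prems assms(2) by simp
  have g: "((\<lambda>x. (t, x)) has_derivative (\<lambda>v. (0, v))) (at x)" for x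
    by (auto intro!: derivative_eq_intros)
  have D: "((\<lambda>x. f (t, x)) has_derivative (\<lambda>v. ddir (0, v) f (t, x))) (at x)" for x
    by (rule has_derivative_compose[OF g has_derivative_ddir[OF d]])
  have "ddir v (\<lambda>x. f (t, x)) = (\<lambda>x. ddir (0, v) f (t, x))" for v
    by (rule ext) (rule ddir_eqI[OF D])
  moreover have "C_k_on k UNIV (\<lambda>x. ddir (0, v) f (t, x))" for v
    using Suc.IH[of "ddir (0, v) f"] Suc.prems by simp
  ultimately show ?case using D by (auto simp: differentiable_def)
qed

lemma smooth_on_slice:
  assumes "open T" "t \<in> T" "smooth_on (T \<times> UNIV) (\<lambda>(t, x). f t x)"
  shows "smooth_on UNIV (f t)"
  using C_k_on_slice[OF assms(1,2), of _ "\<lambda>(t, x). f t x"] assms(3) unfolding smooth_on_def by simp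

text \<open>Joint smoothness makes \<open>f\<close> differentiable in time at each fixed point, so that \<open>vector_derivative\<close> is
the actual derivative.\<close>

lemma smooth_on_time_derivative:
  fixes f :: "real \<Rightarrow> 'a::euclidean_space \<Rightarrow> 'b::real_normed_vector"
  assumes "t \<in> T" "smooth_on (T \<times> UNIV) (\<lambda>(t, x). f t x)"
  shows "((\<lambda>s. f s x) has_vector_derivative vector_derivative (\<lambda>s. f s x) (at t)) (at t)"
proof -
  have d: "(\<lambda>(t, x). f t x) differentiable (at (t, x))"
    by (rule smooth_on_differentiable[OF assms(2)]) (use assms(1) in simp)
  have "((\<lambda>s. (s, x)) has_derivative (\<lambda>h. (h, 0))) (at t)"
    by (auto intro!: derivative_eq_intros)
  from has_derivative_compose[OF this has_derivative_ddir[OF d]]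
  have "(\<lambda>s. f s x) differentiable (at t)" by (auto simp: differentiable_def)
  then show ?thesis by (simp add: vector_derivative_works)
qed

lemma smooth_on_partial: "smooth_on UNIV f \<Longrightarrow> smooth_on UNIV (partial i f)"
  by (simp add: partial_def smooth_on_ddir)

lemma partial_nth:
  fixes f :: "real^3 \<Rightarrow> real^3"
  assumes "f differentiable (at x)"
  shows "partial i (\<lambda>x. f x $ j) x = partial i f x $ j"
  unfolding partial_def
  by (rule ddir_eqI) (rule bounded_linear.has_derivative[OF bounded_linear_vec_nth has_derivative_ddir[OF assms]])

lemma ddir_bounded_linear:
  assumes "bounded_linear L" "f differentiable (at x)"
  shows "ddir v (\<lambda>x. L (f x)) x = L (ddir v f x)"
  by (rule ddir_eqI) (rule bounded_linear.has_derivative[OF assms(1) has_derivative_ddir[OF assms(2)]])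

text \<open>All terms of the momentum equation but the pressure gradient, so that a solution satisfies
\<open>NS_residual = - \<nabla>p\<close>.\<close>

definition NS_residual :: "real \<Rightarrow> velocity \<Rightarrow> real \<Rightarrow> real^3 \<Rightarrow> real^3" where
  "NS_residual \<nu> u t x = vector_derivative (\<lambda>s. u s x) (at t) + ddir (u t x) (u t) x
      - \<nu> *\<^sub>R (\<Sum>i\<in>UNIV. partial i (partial i (u t)) x)"

locale axisymmetric_flow =
  fixes \<nu> :: real and T :: "real set" and u :: velocity
  assumes sol: "ns_solution \<nu> T u"
begin

lemma open_T: "open T" and smooth_joint: "smooth_on (T \<times> UNIV) (\<lambda>(t, x). u t x)"
  and axisym: "axisymmetric T u"
  using sol by (simp_all add: ns_solution_def)

lemma smooth: "t \<in> T \<Longrightarrow> smooth_on UNIV (u t)"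
  by (rule smooth_on_slice[OF open_T _ smooth_joint])

lemma equivariant: "t \<in> T \<Longrightarrow> u t (rot \<theta> x) = rot \<theta> (u t x)"
  by (intro axisymmetric_equivariant[OF axisym] smooth_on_continuous smooth)

text \<open>Every term is built from \<open>u\<close> by operations that commute with rotations, and \<open>u\<close> itself is equivariant.\<close>

lemma NS_residual_equivariant:
  assumes t: "t \<in> T"
  shows "NS_residual \<nu> u t (rot \<theta> x) = rot \<theta> (NS_residual \<nu> u t x)"
proof -
  have d: "f differentiable (at x)" if "smooth_on UNIV f" for f :: "real^3 \<Rightarrow> real^3" and x
    using smooth_on_differentiable[OF that] by simp
  have eq: "(\<lambda>x. u t (rot \<theta> x)) = (\<lambda>x. rot \<theta> (u t x))" using equivariant[OF t] by simp
  have "((\<lambda>s. rot \<theta> (u s x)) has_vector_derivative rot \<theta> (vector_derivative (\<lambda>s. u s x) (at t))) (at t)"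
    by (rule bounded_linear.has_vector_derivative[OF bounded_linear_rot smooth_on_time_derivative[OF t smooth_joint]])
  then have "((\<lambda>s. u s (rot \<theta> x)) has_vector_derivative rot \<theta> (vector_derivative (\<lambda>s. u s x) (at t))) (at t)"
    by (rule has_vector_derivative_transform_within_open[OF _ open_T t]) (simp add: equivariant)
  then have 1: "vector_derivative (\<lambda>s. u s (rot \<theta> x)) (at t) = rot \<theta> (vector_derivative (\<lambda>s. u s x) (at t))"
    by (rule vector_derivative_at)
  have "ddir (u t x) (\<lambda>x. u t (rot \<theta> x)) x = ddir (rot \<theta> (u t x)) (u t) (rot \<theta> x)"
    by (subst ddir_compose)
       (use d[OF smooth[OF t]] in \<open>auto simp: ddir_linear bounded_linear_rot bounded_linear_imp_differentiable\<close>)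
  then have 2: "ddir (u t (rot \<theta> x)) (u t) (rot \<theta> x) = rot \<theta> (ddir (u t x) (u t) x)"
    unfolding eq ddir_bounded_linear[OF bounded_linear_rot d[OF smooth[OF t]]] using equivariant[OF t] by simp
  have "partial i (\<lambda>x. rot \<theta> (f x)) = (\<lambda>x. rot \<theta> (partial i f x))" if "smooth_on UNIV f" for f i
    unfolding partial_def using ddir_bounded_linear[OF bounded_linear_rot d[OF that]] by blast
  then have "partial i (partial i (\<lambda>x. rot \<theta> (u t x))) x = rot \<theta> (partial i (partial i (u t)) x)" for i
    by (simp add: smooth[OF t] smooth_on_partial)
  then have 3: "(\<Sum>i\<in>UNIV. partial i (partial i (u t)) (rot \<theta> x)) = rot \<theta> (\<Sum>i\<in>UNIV. partial i (partial i (u t)) x)"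
    using laplacian_rot[OF smooth[OF t], of \<theta> x, unfolded eq] by (simp add: linear_sum[OF linear_rot])
  show ?thesis
    unfolding NS_residual_def 1 2 3
    by (simp add: linear_add[OF linear_rot] linear_diff[OF linear_rot] linear_cmul[OF linear_rot])
qed

text \<open>The derivative of the pressure along a circle around the axis is \<open>- r\<close> times the azimuthal component of
\<open>NS_residual\<close>, which by equivariance is constant on the circle. The pressure is periodic in the angle, so by
Rolle's theorem this constant vanishes.\<close>

lemma NS_residual_azimuthal:
  assumes t: "t \<in> T" and r: "r > 0"
  shows "NS_residual \<nu> u t (cyl r 0 z) $ 2 = 0"
proof -
  obtain p where p: "smooth_on (T \<times> UNIV) (\<lambda>(t, x). p t x)" "navier_stokes \<nu> T u p"
    using sol unfolding ns_solution_def by blast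
  have dp: "p t differentiable (at x)" for x
    by (rule smooth_on_differentiable[OF smooth_on_slice[OF open_T t p(1)]]) simp
  have NS: "NS_residual \<nu> u t x = - (\<chi> i. partial i (p t) x)" for x
    using p(2) t unfolding navier_stokes_def NS_residual_def by (simp add: algebra_simps)
  let ?P = "\<lambda>\<theta>. p t (cyl r \<theta> z)"
  have D: "(?P has_real_derivative r * ddir (e_theta \<theta>) (p t) (cyl r \<theta> z)) (at \<theta>)" for \<theta>
    by (rule has_derivative_along_circle[OF dp])
  have "\<exists>\<theta>. 0 < \<theta> \<and> \<theta> < 2 * pi \<and> (\<lambda>h. r * ddir (e_theta \<theta>) (p t) (cyl r \<theta> z) * h) = (\<lambda>h. 0)"
  proof (rule Rolle_deriv)
    show "?P 0 = ?P (2 * pi)" by (simp add: cyl_def)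
    show "continuous_on {0..2 * pi} ?P"
      using D by (intro continuous_at_imp_continuous_on ballI DERIV_isCont) blast
    show "(?P has_derivative (\<lambda>h. r * ddir (e_theta \<theta>) (p t) (cyl r \<theta> z) * h)) (at \<theta>)" for \<theta>
      using D[of \<theta>] by (simp add: has_field_derivative_def)
  qed simp
  then obtain \<theta> where "r * ddir (e_theta \<theta>) (p t) (cyl r \<theta> z) = 0" by (metis mult_1_right)
  then have "ddir (e_theta \<theta>) (p t) (cyl r \<theta> z) = 0" using r by simp
  then have "NS_residual \<nu> u t (cyl r \<theta> z) \<bullet> e_theta \<theta> = 0"
    unfolding NS ddir_e_theta[OF dp] by (simp add: inner_vec3 e_theta_def algebra_simps)
  moreover have "NS_residual \<nu> u t (cyl r \<theta> z) = rot \<theta> (NS_residual \<nu> u t (cyl r 0 z))"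
    using NS_residual_equivariant[OF t, of \<theta> "cyl r 0 z"] by (simp add: rot_cyl)
  moreover have "e_theta \<theta> = rot \<theta> (e_theta 0)" by (simp add: rot_e_theta)
  ultimately have "NS_residual \<nu> u t (cyl r 0 z) \<bullet> e_theta 0 = 0" by (simp only: inner_rot)
  then show ?thesis by (simp add: inner_vec3 e_theta_def)
qed

lemma cylindrical_components:
  "u_r u t q = u t (cyl (fst q) 0 (snd q)) $ 1"
  "u_theta u t q = u t (cyl (fst q) 0 (snd q)) $ 2"
  "u_z u t q = u t (cyl (fst q) 0 (snd q)) $ 3"
  by (simp_all add: u_r_def u_theta_def u_z_def e_r_def e_theta_def e_z_def inner_vec3)

lemma component_differentiable:
  assumes "t \<in> T"
  shows "(\<lambda>x. u t x $ j) differentiable (at x)" "(\<lambda>x. partial i (\<lambda>x. u t x $ j) x) differentiable (at x)"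
    "partial k (partial i (\<lambda>x. u t x $ j)) x = partial k (partial i (u t)) x $ j"
    "partial i (\<lambda>x. u t x $ j) x = partial i (u t) x $ j"
proof -
  have d: "u t differentiable (at x)" "partial i (u t) differentiable (at x)" for x
    using smooth_on_differentiable[OF smooth[OF assms]] smooth_on_differentiable[OF smooth_on_partial[OF smooth[OF assms]]]
    by simp_all
  have nth: "(\<lambda>x. f x $ j) differentiable (at x)" if "f differentiable (at x)" for f :: "real^3 \<Rightarrow> real^3" and x
    using bounded_linear.has_derivative[OF bounded_linear_vec_nth has_derivative_ddir[OF that]]
    by (auto simp: differentiable_def)
  show "(\<lambda>x. u t x $ j) differentiable (at x)" by (rule nth[OF d(1)])
  have p: "partial i (\<lambda>x. u t x $ j) = (\<lambda>x. partial i (u t) x $ j)"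
    by (rule ext) (rule partial_nth[OF d(1)])
  show "(\<lambda>x. partial i (\<lambda>x. u t x $ j) x) differentiable (at x)" unfolding p by (rule nth[OF d(2)])
  show "partial k (partial i (\<lambda>x. u t x $ j)) x = partial k (partial i (u t)) x $ j"
    unfolding p by (rule partial_nth[OF d(2)])
  show "partial i (\<lambda>x. u t x $ j) x = partial i (u t) x $ j" by (rule partial_nth[OF d(1)])
qed

text \<open>On a circle around the axis the second Cartesian component of \<open>u\<close> is
\<open>u\<^sup>r sin \<theta> + u\<^sup>\<theta> cos \<theta>\<close>. Its first and second angular derivatives at \<open>\<theta> = 0\<close> determine the derivatives
of \<open>u\<close> normal to the half-plane \<open>\<theta> = 0\<close>.\<close>

lemma azimuthal_partials:
  assumes t: "t \<in> T" and q: "q \<in> half_plane"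
  defines "x \<equiv> cyl (fst q) 0 (snd q)"
  shows "partial 2 (u t) x $ 2 = u_r u t q / fst q"
    and "partial 2 (partial 2 (u t)) x $ 2 = partial 1 (u t) x $ 2 / fst q - u_theta u t q / (fst q)\<^sup>2"
proof -
  have r: "fst q > 0" using q by (simp add: half_plane_iff)
  let ?f = "\<lambda>x. u t x $ 2" and ?c = "\<lambda>\<theta>. cyl (fst q) \<theta> (snd q)"
  note d = component_differentiable[OF t]
  have f: "?f (?c \<theta>) = u_r u t q * sin \<theta> + u_theta u t q * cos \<theta>" for \<theta>
    using axisym t r by (simp add: axisymmetric_def e_r_def e_theta_def e_z_def)
  have "((\<lambda>\<theta>. ?f (?c \<theta>)) has_real_derivative u_r u t q * cos \<theta> - u_theta u t q * sin \<theta>) (at \<theta>)" for \<theta>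
    unfolding f by (auto intro!: derivative_eq_intros)
  then have 1: "fst q * (- sin \<theta> * partial 1 ?f (?c \<theta>) + cos \<theta> * partial 2 ?f (?c \<theta>))
    = u_r u t q * cos \<theta> - u_theta u t q * sin \<theta>" for \<theta>
    using DERIV_unique[OF has_derivative_along_circle[OF d(1)]] unfolding ddir_e_theta[OF d(1)] by blast
  have "fst q * partial 2 ?f x = u_r u t q" using 1[of 0] by (simp add: x_def)
  then show "partial 2 (u t) x $ 2 = u_r u t q / fst q" using r by (simp add: d(4) field_simps)
  have c: "((\<lambda>\<theta>. partial i ?f (?c \<theta>)) has_real_derivative fst q * partial 2 (partial i ?f) x) (at 0)" for i
    using has_derivative_along_circle[OF d(2)[where i = i and j = 2], of "fst q" "snd q" 0] ddir_e_theta[OF d(2), of 0]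
    by (simp add: x_def)
  have "((\<lambda>\<theta>. fst q * (- sin \<theta> * partial 1 ?f (?c \<theta>) + cos \<theta> * partial 2 ?f (?c \<theta>))) has_real_derivative
     fst q * (- partial 1 ?f x + fst q * partial 2 (partial 2 ?f) x)) (at 0)"
    by (auto intro!: derivative_eq_intros c simp: x_def)
  moreover have "((\<lambda>\<theta>. u_r u t q * cos \<theta> - u_theta u t q * sin \<theta>) has_real_derivative - u_theta u t q) (at 0)"
    by (auto intro!: derivative_eq_intros)
  ultimately have "fst q * (- partial 1 ?f x + fst q * partial 2 (partial 2 ?f) x) = - u_theta u t q"
    unfolding 1 using DERIV_unique by blast
  then show "partial 2 (partial 2 (u t)) x $ 2 = partial 1 (u t) x $ 2 / fst q - u_theta u t q / (fst q)\<^sup>2"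
    using r unfolding d(3,4) by (simp add: power2_eq_square field_simps)
qed

lemma meridional_derivatives:
  assumes t: "t \<in> T"
  defines "x \<equiv> \<lambda>q. cyl (fst q) 0 (snd q)"
  shows "u_r u t differentiable (at q)" "u_theta u t differentiable (at q)" "u_z u t differentiable (at q)"
    "D_r (u_theta u t) differentiable (at q)" "D_z (u_theta u t) differentiable (at q)"
    "D_r (u_r u t) q = partial 1 (u t) (x q) $ 1" "D_z (u_z u t) q = partial 3 (u t) (x q) $ 3"
    "D_r (u_theta u t) q = partial 1 (u t) (x q) $ 2" "D_z (u_theta u t) q = partial 3 (u t) (x q) $ 2"
    "D_r (D_r (u_theta u t)) q = partial 1 (partial 1 (u t)) (x q) $ 2"
    "D_z (D_z (u_theta u t)) q = partial 3 (partial 3 (u t)) (x q) $ 2"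
proof -
  have e: "u_r u t = (\<lambda>q. u t (x q) $ 1)" "u_theta u t = (\<lambda>q. u t (x q) $ 2)" "u_z u t = (\<lambda>q. u t (x q) $ 3)"
    by (simp_all add: fun_eq_iff cylindrical_components x_def)
  note d = component_differentiable[OF t]
  have x: "cyl (fst q) 0 (snd q) = x q" for q by (simp add: x_def)
  note m = ddir_meridional[OF d(1), unfolded x]
  have D: "D_r (\<lambda>q. u t (x q) $ j) = (\<lambda>q. partial 1 (\<lambda>x. u t x $ j) (x q))"
     "D_z (\<lambda>q. u t (x q) $ j) = (\<lambda>q. partial 3 (\<lambda>x. u t x $ j) (x q))" for j
    by (rule ext, rule m(2), rule ext, rule m(3))
  note m2 = ddir_meridional[OF d(2), unfolded x]
  show "u_r u t differentiable (at q)" "u_theta u t differentiable (at q)" "u_z u t differentiable (at q)"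
    unfolding e by (rule m)+
  show "D_r (u_theta u t) differentiable (at q)" "D_z (u_theta u t) differentiable (at q)"
    unfolding e D by (rule m2)+
  show "D_r (u_r u t) q = partial 1 (u t) (x q) $ 1" "D_z (u_z u t) q = partial 3 (u t) (x q) $ 3"
    "D_r (u_theta u t) q = partial 1 (u t) (x q) $ 2" "D_z (u_theta u t) q = partial 3 (u t) (x q) $ 2"
    unfolding e D d(4) by (rule refl)+
  show "D_r (D_r (u_theta u t)) q = partial 1 (partial 1 (u t)) (x q) $ 2"
    "D_z (D_z (u_theta u t)) q = partial 3 (partial 3 (u t)) (x q) $ 2"
    unfolding e D m2 d(3) by (rule refl)+
qed

lemma meridional_divergence:
  assumes t: "t \<in> T" and q: "q \<in> half_plane"
  shows "D_r (u_r u t) q + u_r u t q / fst q + D_z (u_z u t) q = 0"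
proof -
  have "(\<Sum>i\<in>UNIV. partial i (u t) (cyl (fst q) 0 (snd q)) $ i) = 0"
    using sol t unfolding ns_solution_def navier_stokes_def by blast
  then show ?thesis
    by (simp add: sum_3 azimuthal_partials[OF t q] meridional_derivatives[OF t])
qed

text \<open>This is the second Cartesian component of the momentum equation at a point of the half-plane \<open>\<theta> = 0\<close>,
where that direction is \<open>e\<^sub>\<theta>\<close>.\<close>

lemma swirl_equation:
  assumes t: "t \<in> T" and q: "q \<in> half_plane"
  shows "deriv (\<lambda>s. u_theta u s q) t + u_r u t q * D_r (u_theta u t) q + u_z u t q * D_z (u_theta u t) q
      + u_theta u t q * u_r u t q / fst q
    = \<nu> * (D_r (D_r (u_theta u t)) q + D_r (u_theta u t) q / fst q - u_theta u t q / (fst q)\<^sup>2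
        + D_z (D_z (u_theta u t)) q)"
    and "(\<lambda>s. u_theta u s q) differentiable (at t)"
proof -
  let ?x = "cyl (fst q) 0 (snd q)"
  have r: "fst q > 0" using q by (simp add: half_plane_iff)
  have d: "u t differentiable (at x)" for x using smooth_on_differentiable[OF smooth[OF t]] by simp
  have "((\<lambda>s. u s ?x $ 2) has_vector_derivative vector_derivative (\<lambda>s. u s ?x) (at t) $ 2) (at t)"
    by (rule bounded_linear.has_vector_derivative[OF bounded_linear_vec_nth smooth_on_time_derivative[OF t smooth_joint]])
  then have D: "((\<lambda>s. u_theta u s q) has_real_derivative vector_derivative (\<lambda>s. u s ?x) (at t) $ 2) (at t)"
    by (simp add: cylindrical_components has_real_derivative_iff_has_vector_derivative)
  then show "(\<lambda>s. u_theta u s q) differentiable (at t)" by (meson real_differentiable_def)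
  have "u t ?x = u t ?x $ 1 *\<^sub>R axis 1 1 + u t ?x $ 2 *\<^sub>R axis 2 1 + u t ?x $ 3 *\<^sub>R axis 3 1"
    by (simp add: vec3_eq_iff axis_nth_3)
  then have "ddir (u t ?x) (u t) ?x = ddir (u t ?x $ 1 *\<^sub>R axis 1 1 + u t ?x $ 2 *\<^sub>R axis 2 1 + u t ?x $ 3 *\<^sub>R axis 3 1) (u t) ?x"
    by (rule arg_cong)
  then have "ddir (u t ?x) (u t) ?x = u t ?x $ 1 *\<^sub>R partial 1 (u t) ?x + u t ?x $ 2 *\<^sub>R partial 2 (u t) ?x + u t ?x $ 3 *\<^sub>R partial 3 (u t) ?x"
    by (simp only: linear_add[OF linear_ddir[OF d]] linear_cmul[OF linear_ddir[OF d]] partial_def)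
  then have "vector_derivative (\<lambda>s. u s ?x) (at t) $ 2
      + (u_r u t q * partial 1 (u t) ?x $ 2 + u_theta u t q * partial 2 (u t) ?x $ 2 + u_z u t q * partial 3 (u t) ?x $ 2)
    - \<nu> * (partial 1 (partial 1 (u t)) ?x $ 2 + partial 2 (partial 2 (u t)) ?x $ 2 + partial 3 (partial 3 (u t)) ?x $ 2) = 0"
    using NS_residual_azimuthal[OF t r, of "snd q"]
    by (simp add: NS_residual_def sum_3 cylindrical_components)
  then show "deriv (\<lambda>s. u_theta u s q) t + u_r u t q * D_r (u_theta u t) q + u_z u t q * D_z (u_theta u t) q
      + u_theta u t q * u_r u t q / fst q
    = \<nu> * (D_r (D_r (u_theta u t)) q + D_r (u_theta u t) q / fst q - u_theta u t q / (fst q)\<^sup>2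
        + D_z (D_z (u_theta u t)) q)"
    unfolding DERIV_imp_deriv[OF D] azimuthal_partials[OF t q] meridional_derivatives[OF t] by (simp add: algebra_simps)
qed

end

section \<open>Conservation form and the source pairing\<close>

lemma ddir_div_fst:
  assumes "q \<in> half_plane" "v differentiable (at q)"
  shows "(\<lambda>q. v q / fst q) differentiable (at q)"
    and "ddir w (\<lambda>q. v q / fst q) q = ddir w v q / fst q - v q * fst w / (fst q)\<^sup>2"
proof -
  have "fst q > 0" using assms(1) by (simp add: half_plane_iff)
  then have D: "((\<lambda>q. v q / fst q) has_derivative (\<lambda>w. ddir w v q / fst q - v q * fst w / (fst q)\<^sup>2)) (at q)"
    by (auto intro!: derivative_eq_intros has_derivative_ddir[OF assms(2)] simp: power2_eq_square field_simps)
  then show "(\<lambda>q. v q / fst q) differentiable (at q)" by (auto simp: differentiable_def)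
  show "ddir w (\<lambda>q. v q / fst q) q = ddir w v q / fst q - v q * fst w / (fst q)\<^sup>2"
    by (rule ddir_eqI[OF D])
qed

text \<open>Division by \<open>r\<close> conjugates \<open>\<Delta>\<^sub>5\<close> to the azimuthal component of the vector Laplacian.\<close>

lemma Delta5_div_fst:
  assumes q: "q \<in> half_plane" and v: "\<And>q. v differentiable (at q)"
    and Dv: "D_r v differentiable (at q)" "D_z v differentiable (at q)"
  shows "Delta5 (\<lambda>q. v q / fst q) q
    = (D_r (D_r v) q + D_r v q / fst q - v q / (fst q)\<^sup>2 + D_z (D_z v) q) / fst q"
proof -
  have r: "fst q > 0" using q by (simp add: half_plane_iff)
  have "D_r (D_r (\<lambda>q. v q / fst q)) q = D_r (\<lambda>q. D_r v q / fst q - v q / fst q / fst q) q"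
    by (rule ddir_cong_open[OF open_half_plane q]) (simp add: ddir_div_fst v power2_eq_square)
  also have "\<dots> = D_r (D_r v) q / fst q - D_r v q / (fst q)\<^sup>2
      - ((D_r v q / fst q - v q / (fst q)\<^sup>2) / fst q - v q / fst q / (fst q)\<^sup>2)"
    using ddir_div_fst[OF q Dv(1)] ddir_div_fst[OF q v] ddir_div_fst[OF q ddir_div_fst(1)[OF q v]]
    by (simp add: ddir_diff)
  finally have rr: "D_r (D_r (\<lambda>q. v q / fst q)) q = D_r (D_r v) q / fst q - D_r v q / (fst q)\<^sup>2
      - ((D_r v q / fst q - v q / (fst q)\<^sup>2) / fst q - v q / fst q / (fst q)\<^sup>2)" .
  have "D_z (D_z (\<lambda>q. v q / fst q)) q = D_z (\<lambda>q. D_z v q / fst q) q"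
    by (rule ddir_cong_open[OF open_half_plane q]) (simp add: ddir_div_fst v)
  then have zz: "D_z (D_z (\<lambda>q. v q / fst q)) q = D_z (D_z v) q / fst q"
    by (simp add: ddir_div_fst[OF q Dv(2)])
  show ?thesis
    unfolding Delta5_def rr zz using r
    by (simp add: ddir_div_fst[OF q v] power2_eq_square field_simps)
qed

text \<open>With respect to \<open>\<mu>\<^sub>3\<close> a divergence-free axisymmetric field \<open>(a, b)\<close> has divergence \<open>2 a / r\<close>. Against the
term \<open>- a v / r\<^sup>2\<close> from differentiating \<open>v / r\<close> this leaves \<open>a v / r\<^sup>2\<close>, which is the term
\<open>u\<^sup>r u\<^sup>\<theta> / r\<close> of the swirl equation divided by \<open>r\<close>.\<close>

lemma div_mu_3_div_fst:
  assumes q: "q \<in> half_plane" and d: "a differentiable (at q)" "b differentiable (at q)" "v differentiable (at q)"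
    and div: "D_r a q + a q / fst q + D_z b q = 0"
  shows "div_mu 3 (\<lambda>q. a q * (v q / fst q)) (\<lambda>q. b q * (v q / fst q)) q
    = (a q * D_r v q + b q * D_z v q + v q * a q / fst q) / fst q"
proof -
  have r: "fst q > 0" using q by (simp add: half_plane_iff)
  let ?F = "\<lambda>q. v q / fst q"
  note F = ddir_div_fst[OF q d(3)]
  have aF: "(\<lambda>q. a q * ?F q) differentiable (at q)" "(\<lambda>q. b q * ?F q) differentiable (at q)"
    by (intro differentiable_mult d F)+
  have "fst q powr - 3 = 1 / fst q ^ 3" "fst q powr 3 = fst q ^ 3" "fst q powr (3 - 1) = (fst q)\<^sup>2"
    using r by (simp_all add: powr_minus divide_inverse)
  moreover have "1 / s ^ 3 * (s ^ 3 * X + 3 * s\<^sup>2 * 1 * A + (s ^ 3 * Y + 3 * s\<^sup>2 * 0 * B)) = 3 * A / s + X + Y"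
    if "s > 0" for s X Y A B :: real
    using that by (simp add: power2_eq_square power3_eq_cube field_simps)
  ultimately have "div_mu 3 (\<lambda>q. a q * ?F q) (\<lambda>q. b q * ?F q) q
    = 3 * (a q * ?F q) / fst q + D_r (\<lambda>q. a q * ?F q) q + D_z (\<lambda>q. b q * ?F q) q"
    using r by (simp only: div_mu_def ddir_mult[OF differentiable_powr_fst[OF q] aF(1)]
      ddir_mult[OF differentiable_powr_fst[OF q] aF(2)] ddir_powr_fst[OF q] fst_conv)
  also have "\<dots> = 3 * (a q * ?F q) / fst q + (a q * (D_r v q / fst q - v q / (fst q)\<^sup>2) + D_r a q * ?F q)
     + (b q * (D_z v q / fst q) + D_z b q * ?F q)"
    unfolding ddir_mult[OF d(1) F(1)] ddir_mult[OF d(2) F(1)] by (simp add: F(2))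
  also have "\<dots> = (a q * D_r v q + b q * D_z v q + v q * a q / fst q) / fst q
      + (D_r a q + a q / fst q + D_z b q) * ?F q"
    using r by (simp add: power2_eq_square field_simps)
  finally show ?thesis unfolding div by simp
qed

context axisymmetric_flow
begin

lemma F_equation:
  assumes t: "t \<in> T" and q: "q \<in> half_plane"
  shows "deriv (\<lambda>s. F_of u s q) t
      + div_mu 3 (\<lambda>q. u_r u t q * F_of u t q) (\<lambda>q. u_z u t q * F_of u t q) q
    = \<nu> * Delta5 (F_of u t) q"
proof -
  have F: "F_of u t = (\<lambda>q. u_theta u t q / fst q)" by (simp add: fun_eq_iff F_of_def)
  note m = meridional_derivatives(1-5)[OF t]
  have "deriv (\<lambda>s. F_of u s q) t = deriv (\<lambda>s. u_theta u s q) t / fst q"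
    unfolding F_of_def using swirl_equation(2)[OF t q]
    by (intro deriv_cdivide_right) (simp add: field_differentiable_def real_differentiable_def)
  then show ?thesis
    unfolding F Delta5_div_fst[OF q m(2,4,5)] div_mu_3_div_fst[OF q m(1,3,2) meridional_divergence[OF t q]]
    using swirl_equation(1)[OF t q] by (simp add: add_divide_distrib[symmetric] add.assoc)
qed

text \<open>Both sides are \<open>2 r u\<^sup>\<theta> \<partial>\<^sub>z u\<^sup>\<theta>\<close>.\<close>

lemma G_source:
  assumes t: "t \<in> T" and q: "q \<in> half_plane"
  shows "D_z (\<lambda>q. (F_of u t q)\<^sup>2) q * fst q powr 3 = 2 * (Gamma_of u t q * W_of u t q)"
proof -
  have r: "fst q > 0" using q by (simp add: half_plane_iff)
  have F: "F_of u t = (\<lambda>q. u_theta u t q / fst q)" by (simp add: fun_eq_iff F_of_def)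
  note v = meridional_derivatives(2)[OF t]
  have "D_z (\<lambda>q. (F_of u t q)\<^sup>2) q = 2 * (u_theta u t q / fst q) * (D_z (u_theta u t) q / fst q)"
    unfolding power2_eq_square F ddir_mult[OF ddir_div_fst(1)[OF q v] ddir_div_fst(1)[OF q v]]
    by (simp add: ddir_div_fst(2)[OF q v])
  moreover have "D_z (Gamma_of u t) q = fst q * D_z (u_theta u t) q"
    unfolding Gamma_of_def[abs_def]
    by (simp add: ddir_mult v bounded_linear_imp_differentiable bounded_linear_fst ddir_linear)
  ultimately show ?thesis
    using r by (simp add: W_of_def Gamma_of_def power3_eq_cube)
qed

end

lemma conservative_F_3: "conservative_F \<nu> 3"
  unfolding conservative_F_def
  using axisymmetric_flow.F_equation axisymmetric_flow.intro by blast

lemma unweighted_G_source_3: "unweighted_G_source \<nu> 3"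
  unfolding unweighted_G_source_def
proof (intro allI impI ballI)
  fix T u t assume "ns_solution \<nu> T u" and t: "t \<in> T"
  then interpret axisymmetric_flow \<nu> T u by unfold_locales
  have "integral_mu 3 (\<lambda>q. G_of u t q * D_z (\<lambda>q. (F_of u t q)\<^sup>2) q)
    = (\<integral>q. 2 * (indicator half_plane q *\<^sub>R (Gamma_of u t q * W_of u t q * G_of u t q)) \<partial>lborel)"
    unfolding integral_mu_def set_lebesgue_integral_def
  proof (rule Bochner_Integration.integral_cong)
    fix q
    show "indicator half_plane q *\<^sub>R (G_of u t q * D_z (\<lambda>q. (F_of u t q)\<^sup>2) q * fst q powr 3)
      = 2 * (indicator half_plane q *\<^sub>R (Gamma_of u t q * W_of u t q * G_of u t q))"
      using G_source[OF t, of q] by (cases "q \<in> half_plane") (simp_all add: mult.assoc)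
  qed simp
  then show "integral_mu 3 (\<lambda>q. G_of u t q * D_z (\<lambda>q. (F_of u t q)\<^sup>2) q)
    = 2 * (LINT q:half_plane|lborel. Gamma_of u t q * W_of u t q * G_of u t q)"
    by (simp only: integral_mult_right_zero set_lebesgue_integral_def)
qed

section \<open>The distinguished exponent\<close>

theorem theorem7p1:
  fixes \<nu> :: real
  assumes "\<nu> > 0"
  shows
    "(\<forall>\<alpha>>1. conservative_F \<nu> \<alpha> \<and> Delta5_self_adjoint \<alpha> \<and> unweighted_G_source \<nu> \<alpha> \<longleftrightarrow> \<alpha> = 3)
    \<and> (\<forall>\<alpha>\<in>{3..<5}.
          G_gap \<alpha> = (5 - \<alpha>) / (\<alpha> - 1)
        \<and> G_strain \<alpha> / G_gap \<alpha> = (\<alpha> - 1)\<^sup>2 / (2 * (5 - \<alpha>))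
        \<and> form_bound_threshold \<nu> (G_strain \<alpha>) (G_gap \<alpha>) = 2 * \<nu> * (5 - \<alpha>) / (\<alpha> - 1)\<^sup>2)
    \<and> (\<forall>\<beta>. is_arg_min (\<lambda>\<alpha>. G_strain \<alpha> / G_gap \<alpha>) (\<lambda>\<alpha>. \<alpha> \<in> {3..<5}) \<beta> \<longleftrightarrow> \<beta> = 3)
    \<and> (\<forall>\<beta>. is_arg_max (\<lambda>\<alpha>. form_bound_threshold \<nu> (G_strain \<alpha>) (G_gap \<alpha>))
            (\<lambda>\<alpha>. \<alpha> \<in> {3..<5}) \<beta> \<longleftrightarrow> \<beta> = 3)
    \<and> (\<forall>p>1.
          (\<forall>\<alpha>\<in>{3..<2 * p + 1}.
              F_gap \<alpha> p = 4 * (2 * p + 1 - \<alpha>) / (p\<^sup>2 * (\<alpha> - 1))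
            \<and> F_strain \<alpha> p / F_gap \<alpha> p = p * (\<alpha> - 1) / 4
            \<and> form_bound_threshold \<nu> (F_strain \<alpha> p) (F_gap \<alpha> p) = 4 * \<nu> / (p * (\<alpha> - 1)))
        \<and> (\<forall>\<beta>. is_arg_min (\<lambda>\<alpha>. F_strain \<alpha> p / F_gap \<alpha> p) (\<lambda>\<alpha>. \<alpha> \<in> {3..<2 * p + 1}) \<beta> \<longleftrightarrow> \<beta> = 3)
        \<and> (\<forall>\<beta>. is_arg_max (\<lambda>\<alpha>. form_bound_threshold \<nu> (F_strain \<alpha> p) (F_gap \<alpha> p))
                (\<lambda>\<alpha>. \<alpha> \<in> {3..<2 * p + 1}) \<beta> \<longleftrightarrow> \<beta> = 3))"
proof (intro conjI allI ballI impI)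
  show "conservative_F \<nu> \<alpha> \<and> Delta5_self_adjoint \<alpha> \<and> unweighted_G_source \<nu> \<alpha> \<longleftrightarrow> \<alpha> = 3" for \<alpha>
    using Delta5_self_adjoint_iff conservative_F_3 unweighted_G_source_3 by blast
next
  fix \<alpha> :: real assume \<alpha>: "\<alpha> \<in> {3..<5}"
  show "G_gap \<alpha> = (5 - \<alpha>) / (\<alpha> - 1)" using G_gap_eq \<alpha> by simp
  show "G_strain \<alpha> / G_gap \<alpha> = (\<alpha> - 1)\<^sup>2 / (2 * (5 - \<alpha>))" by (rule G_ratios(1)[OF \<alpha>])
  show "form_bound_threshold \<nu> (G_strain \<alpha>) (G_gap \<alpha>) = 2 * \<nu> * (5 - \<alpha>) / (\<alpha> - 1)\<^sup>2"
    by (rule G_ratios(2)[OF \<alpha>])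
next
  show "is_arg_min (\<lambda>\<alpha>. G_strain \<alpha> / G_gap \<alpha>) (\<lambda>\<alpha>. \<alpha> \<in> {3..<5}) \<beta> \<longleftrightarrow> \<beta> = 3" for \<beta>
    by (rule G_ratio_minimal)
  show "is_arg_max (\<lambda>\<alpha>. form_bound_threshold \<nu> (G_strain \<alpha>) (G_gap \<alpha>)) (\<lambda>\<alpha>. \<alpha> \<in> {3..<5}) \<beta>
      \<longleftrightarrow> \<beta> = 3" for \<beta>
    by (rule G_threshold_maximal[OF assms])
next
  fix p \<alpha> :: real assume p: "p > 1" and \<alpha>: "\<alpha> \<in> {3..<2 * p + 1}"
  then have p0: "p > 0" by simp
  show "F_gap \<alpha> p = 4 * (2 * p + 1 - \<alpha>) / (p\<^sup>2 * (\<alpha> - 1))" using F_gap_eq \<alpha> p0 by simp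
  show "F_strain \<alpha> p / F_gap \<alpha> p = p * (\<alpha> - 1) / 4" by (rule F_ratios(1)[OF p0 \<alpha>])
  show "form_bound_threshold \<nu> (F_strain \<alpha> p) (F_gap \<alpha> p) = 4 * \<nu> / (p * (\<alpha> - 1))"
    by (rule F_ratios(2)[OF p0 \<alpha>])
next
  fix p :: real assume p: "p > 1"
  show "is_arg_min (\<lambda>\<alpha>. F_strain \<alpha> p / F_gap \<alpha> p) (\<lambda>\<alpha>. \<alpha> \<in> {3..<2 * p + 1}) \<beta> \<longleftrightarrow> \<beta> = 3" for \<beta>
    by (rule F_ratio_minimal[OF p])
  show "is_arg_max (\<lambda>\<alpha>. form_bound_threshold \<nu> (F_strain \<alpha> p) (F_gap \<alpha> p))
      (\<lambda>\<alpha>. \<alpha> \<in> {3..<2 * p + 1}) \<beta> \<longleftrightarrow> \<beta> = 3" for \<beta>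
    by (rule F_threshold_maximal[OF assms p])
qed

end
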